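(* Let $1\le n\le N$ be integers, let $\psi_0\in\mathbb{C}^{2^n}$ be a unit vector, and let $H_j=\mathrm{diag}(k^{(j)}_1,\dots,k^{(j)}_{2^n})$, $j=1,\dots,N$, be linearly independent diagonal matrices with integer entries. Let $U(\boldsymbol{\theta})=e^{i(\theta_1H_1+\dots+\theta_NH_N)}$ for $\boldsymbol{\theta}\in[-\pi,\pi]^N$. Let $K$ be the random variable, and $V_U$ the volume of the lattice $\mathrm{lat}(W)$, defined in the context. Define the approximate frame potential by $$\tilde{\mathcal{F}}_U(t)=\frac{V_U}{(4\pi t)^{N/2}\sqrt{\det(\mathrm{Var}(K))}}.$$ Then there exists $c>0$ such that $|\mathcal{F}_U(t)-\tilde{\mathcal{F}}_U(t)|<c\,t^{-(N/2+1)}$ for all integers $t>0$.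
   Context: Frame potential: with fidelity $F_U(\boldsymbol{\theta},\boldsymbol{\theta}')=|\langle\psi_0|U(\boldsymbol{\theta})^\dagger U(\boldsymbol{\theta}')|\psi_0\rangle|^2$, set $$\mathcal{F}_U(t)=\frac{1}{(2\pi)^{2N}}\int_{[-\pi,\pi]^{2N}}F_U(\boldsymbol{\theta},\boldsymbol{\theta}')^t\,d\boldsymbol{\theta}\,d\boldsymbol{\theta}'.$$ For $x=1,\dots,2^n$ let $\boldsymbol{k}_x=(k^{(1)}_x,\dots,k^{(N)}_x)\in\mathbb{Z}^N$, let $|x\rangle$ denote the $x$-th standard basis vector of $\mathbb{C}^{2^n}$, and let $\boldsymbol{\Omega}=\{\boldsymbol{k}_x: x=1,\dots,2^n\}$. Let $X$ be a random index with $\mathbb{P}(X=x)=|\langle\psi_0|x\rangle|^2$, and let $K=\boldsymbol{k}_X$, so that $\langle\psi_0|U(\boldsymbol{\theta})|\psi_0\rangle=\mathbb{E}\,e^{i\boldsymbol{\theta}\cdot K}$; $\mathrm{Var}(K)\in\mathbb{R}^{N\times N}$ is the covariance matrix of $K$. Let $\boldsymbol{\Delta}=\{\boldsymbol{k}-\boldsymbol{k}':\boldsymbol{k},\boldsymbol{k}'\in\boldsymbol{\Omega}\}$. The random walk is $W_t=D_1+\dots+D_t$, where the $D_s$ are independent and distributed as $K-K'$ with $K'$ an independent copy of $K$. Its lattice is $\mathrm{lat}(W)=\mathrm{span}_{\mathbb{Z}}(\boldsymbol{\Delta})\subseteq\mathbb{Z}^N$. The volume of this lattice is $V_U=|\det(\boldsymbol{\Delta}^*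 )|$, where $\boldsymbol{\Delta}^*$ is an $N\times N$ matrix whose rows are selected from $\boldsymbol{\Delta}$ and whose row space over the integers equals $\mathrm{lat}(W)$.
   Formalization: Two conditions are added: det(Var(K)) is nonzero (otherwise the approximate frame potential is undefined), and the values K-K' of positive probability generate lat(W)=span_Z(Δ); when ψ_0 has zero amplitudes this can fail and the claim is then false. *)

theory Defs
  imports "HOL-Probability.Probability"
begin

section \<open>Matrix exponential and unitaries generated by diagonal Hamiltonians\<close>

text \<open>
  The instance of \<open>times\<close> for \<open>vec\<close> is the pointwise product, so the powers below are taken
  with respect to \<open>**\<close>, and the series is a limit in the finite-dimensional space of matrices.
\<close>

primrec matrix_pow :: "complex^'d^'d \<Rightarrow> nat \<Rightarrow> complex^'d^'d" where
  "matrix_pow A 0 = mat 1"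
| "matrix_pow A (Suc m) = A ** matrix_pow A m"

definition matrix_exp :: "complex^'d^'d \<Rightarrow> complex^'d^'d" where
  "matrix_exp A = (\<Sum>m. (1 / fact m) *\<^sub>R matrix_pow A m)"

definition adjoint_matrix :: "complex^'d^'d \<Rightarrow> complex^'d^'d" where
  "adjoint_matrix A = (\<chi> x y. cnj (A $ y $ x))"

definition cinner :: "complex^'d \<Rightarrow> complex^'d \<Rightarrow> complex" where
  "cinner \<phi> \<psi> = (\<Sum>x\<in>UNIV. cnj (\<phi> $ x) * \<psi> $ x)"

text \<open>
  The basis of the state space is indexed by a finite type \<open>'d\<close>, the parameters by a finite
  type \<open>'N\<close>; \<open>k x\<close> is the integer frequency vector of the basis state \<open>x\<close>, so the \<open>j\<close>-th
  Hamiltonian carries the \<open>j\<close>-th components of these vectors on its diagonal.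
\<close>

definition hamiltonian :: "('d \<Rightarrow> int^'N) \<Rightarrow> 'N \<Rightarrow> complex^'d^'d" where
  "hamiltonian k j = (\<chi> x y. if x = y then of_int (k x $ j) else 0)"

text \<open>Multiplication by \<open>mat \<i>\<close> is multiplication by the imaginary unit.\<close>

definition evolution :: "('d \<Rightarrow> int^'N) \<Rightarrow> real^'N \<Rightarrow> complex^'d^'d" where
  "evolution k \<theta> = matrix_exp (mat \<i> ** (\<Sum>j\<in>UNIV. (\<theta> $ j) *\<^sub>R hamiltonian k j))"

lemma matrix_pow_diagonal:
  "matrix_pow (\<chi> x y. if x = y then a x else 0) m = (\<chi> x y. if x = y then a x ^ m else 0)"
  by (induction m) (simp_all add: vec_eq_iff mat_def matrix_matrix_mult_def if_distrib
        if_distribR cong: if_cong)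

lemma matrix_exp_diagonal:
  "matrix_exp (\<chi> x y. if x = y then a x else 0) = (\<chi> x y. if x = y then exp (a x) else 0)"
proof -
  have "(\<lambda>m. (1 / fact m) *\<^sub>R matrix_pow (\<chi> x y. if x = y then a x else 0) m)
          sums (\<chi> x y. if x = y then exp (a x) else 0)"
    unfolding sums_def
  proof (intro vec_tendstoI)
    fix x y
    have "(\<lambda>m. a x ^ m /\<^sub>R fact m) sums exp (a x)" by (rule exp_converges)
    then show "(\<lambda>n. (\<Sum>m<n. (1 / fact m) *\<^sub>R
          matrix_pow (\<chi> x y. if x = y then a x else 0) m) $ x $ y)
        \<longlonglongrightarrow> (\<chi> x y. if x = y then exp (a x) else 0) $ x $ y"
      by (cases "x = y") (simp_all add: matrix_pow_diagonal sums_def inverse_eq_divide)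
  qed
  then show ?thesis by (simp add: matrix_exp_def sums_iff)
qed

lemma evolution_eq:
  "evolution k \<theta> =
     (\<chi> x y. if x = y then exp (\<i> * of_real (\<Sum>j\<in>UNIV. \<theta> $ j * real_of_int (k x $ j))) else 0)"
proof -
  have "mat \<i> ** (\<Sum>j\<in>UNIV. (\<theta> $ j) *\<^sub>R hamiltonian k j) =
     (\<chi> x y. if x = y then \<i> * of_real (\<Sum>j\<in>UNIV. \<theta> $ j * real_of_int (k x $ j)) else 0)"
    by (simp add: vec_eq_iff matrix_matrix_mult_def mat_def hamiltonian_def if_distrib
        if_distribR scaleR_conv_of_real[where 'a = complex] cong: if_cong)
  then show ?thesis by (simp add: evolution_def matrix_exp_diagonal)
qed

definition fidelity :: "complex^'d \<Rightarrow> ('d \<Rightarrow> int^'N) \<Rightarrow> real^'N \<Rightarrow> real^'N \<Rightarrow> real" where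
  "fidelity \<psi> k \<theta> \<theta>' =
     (cmod (cinner \<psi> ((adjoint_matrix (evolution k \<theta>) ** evolution k \<theta>') *v \<psi>)))\<^sup>2"

definition param_cube :: "(real^'N) set" where
  "param_cube = cbox (\<chi> j. - pi) (\<chi> j. pi)"

definition frame_potential :: "complex^'d \<Rightarrow> ('d \<Rightarrow> int^'N) \<Rightarrow> nat \<Rightarrow> real" where
  "frame_potential \<psi> k t =
     1 / (2 * pi) ^ (2 * CARD('N)) *
     (LINT p : param_cube \<times> param_cube | lborel. fidelity \<psi> k (fst p) (snd p) ^ t)"

section \<open>The random frequency vector and the random walk\<close>

text \<open>
  The weights in \<open>index_pmf\<close> sum to one precisely when \<open>\<psi>\<close> is a unit vector;
  \<open>embed_pmf\<close> is unspecified otherwise.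
\<close>

definition index_pmf :: "complex^'d \<Rightarrow> 'd pmf" where
  "index_pmf \<psi> = embed_pmf (\<lambda>x. (cmod (cinner \<psi> (axis x 1)))\<^sup>2)"

definition freq_pmf :: "complex^'d \<Rightarrow> ('d \<Rightarrow> int^'N) \<Rightarrow> (int^'N) pmf" where
  "freq_pmf \<psi> k = map_pmf k (index_pmf \<psi>)"

lemma pmf_index_pmf:
  assumes "norm \<psi> = 1"
  shows "pmf (index_pmf \<psi>) x = (cmod (\<psi> $ x))\<^sup>2"
proof -
  have inn: "cinner \<psi> (axis y 1) = cnj (\<psi> $ y)" for y
    by (simp add: cinner_def axis_def if_distrib cong: if_cong)
  have "(\<Sum>y\<in>UNIV. (cmod (\<psi> $ y))\<^sup>2) = 1"
    using assms by (simp add: norm_vec_def L2_set_def)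
  then have "(\<integral>\<^sup>+ y. ennreal ((cmod (\<psi> $ y))\<^sup>2) \<partial>count_space UNIV) = 1"
    by (simp add: nn_integral_count_space_finite)
  then show ?thesis
    unfolding index_pmf_def inn by (subst pmf_embed_pmf) simp_all
qed

lemma cinner_evolution_eq_expectation:
  assumes "norm \<psi> = 1"
  shows "cinner \<psi> (evolution k \<theta> *v \<psi>) =
    measure_pmf.expectation (freq_pmf \<psi> k)
      (\<lambda>v. exp (\<i> * of_real (\<Sum>j\<in>UNIV. \<theta> $ j * real_of_int (v $ j))))"
proof -
  have "cinner \<psi> (evolution k \<theta> *v \<psi>) = (\<Sum>x\<in>UNIV. of_real ((cmod (\<psi> $ x))\<^sup>2) *
      exp (\<i> * of_real (\<Sum>j\<in>UNIV. \<theta> $ j * real_of_int (k x $ j))))"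
    by (simp add: cinner_def evolution_eq matrix_vector_mult_def if_distrib if_distribR
        complex_norm_square mult_ac cong: if_cong del: of_real_power of_real_sum)
  then show ?thesis
    unfolding freq_pmf_def integral_map_pmf
    by (subst integral_measure_pmf[of UNIV])
       (simp_all add: pmf_index_pmf[OF assms] scaleR_conv_of_real)
qed

definition covariance_matrix :: "(int^'N) pmf \<Rightarrow> real^'N^'N" where
  "covariance_matrix p = (\<chi> i j. measure_pmf.expectation p (\<lambda>v.
      (real_of_int (v $ i) - measure_pmf.expectation p (\<lambda>w. real_of_int (w $ i))) *
      (real_of_int (v $ j) - measure_pmf.expectation p (\<lambda>w. real_of_int (w $ j)))))"

definition step_pmf :: "complex^'d \<Rightarrow> ('d \<Rightarrow> int^'N) \<Rightarrow> (int^'N) pmf" where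
  "step_pmf \<psi> k = map_pmf (\<lambda>(v, w). v - w) (pair_pmf (freq_pmf \<psi> k) (freq_pmf \<psi> k))"

section \<open>Lattices and their volume\<close>

global_interpretation int_vec: module "(*s) :: int \<Rightarrow> int^'N \<Rightarrow> int^'N"
  by unfold_locales (simp_all add: vec_eq_iff algebra_simps)

definition frequencies :: "('d \<Rightarrow> int^'N) \<Rightarrow> (int^'N) set" where
  "frequencies k = range k"

definition freq_differences :: "('d \<Rightarrow> int^'N) \<Rightarrow> (int^'N) set" where
  "freq_differences k = {v - w | v w. v \<in> frequencies k \<and> w \<in> frequencies k}"

definition walk_lattice :: "('d \<Rightarrow> int^'N) \<Rightarrow> (int^'N) set" where
  "walk_lattice k = int_vec.span (freq_differences k)"

text \<open>
  A generating set of a lattice need not contain a basis (the differences of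
  \<open>{0, 6, 10, 15}\<close> generate the integers), so the rows are not required to belong to a given
  generating set. By \<open>lattice_volume_eq\<close> and \<open>lattice_basis_matrix_exists\<close> below, the value
  is well defined for every sublattice of the integer lattice, and it is the absolute
  determinant of any matrix whose rows are selected from a generating set and span the
  lattice, whenever there is such a selection.
\<close>

definition lattice_volume :: "(int^'N) set \<Rightarrow> real" where
  "lattice_volume L = real_of_int \<bar>det (SOME B :: int^'N^'N. int_vec.span (rows B) = L)\<bar>"

lemma span_rows_imp_matrix_mult:
  fixes A B :: "int^'N^'N"
  assumes "rows A \<subseteq> int_vec.span (rows B)"
  shows "\<exists>P :: int^'N^'N. A = P ** B"
proof -
  have sub: "int_vec.span (rows B) \<subseteq> range (\<lambda>c :: int^'N. c v* B)"
  proof (rule int_vec.span_minimal)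
    show "rows B \<subseteq> range (\<lambda>c :: int^'N. c v* B)"
    proof
      fix r assume "r \<in> rows B"
      then obtain i where "r = row i B" by (auto simp: rows_def)
      then have "r = axis i 1 v* B"
        by (simp add: vec_eq_iff row_def vector_matrix_mult_def axis_def if_distrib
              if_distribR cong: if_cong)
      then show "r \<in> range (\<lambda>c. c v* B)" by blast
    qed
    show "int_vec.subspace (range (\<lambda>c :: int^'N. c v* B))"
    proof (rule int_vec.subspaceI)
      show "0 \<in> range (\<lambda>c :: int^'N. c v* B)"
        by (rule image_eqI[of _ _ 0]) (simp_all add: vec_eq_iff vector_matrix_mult_def)
    next
      fix x y assume "x \<in> range (\<lambda>c :: int^'N. c v* B)" "y \<in> range (\<lambda>c :: int^'N. c v* B)"
      then obtain c d where "x = c v* B" "y = d v* B" by blast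
      then have "x + y = (c + d) v* B"
        by (simp add: vec_eq_iff vector_matrix_mult_def algebra_simps sum.distrib)
      then show "x + y \<in> range (\<lambda>c :: int^'N. c v* B)" by blast
    next
      fix a x assume "x \<in> range (\<lambda>c :: int^'N. c v* B)"
      then obtain c where "x = c v* B" by blast
      then have "a *s x = (a *s c) v* B"
        by (simp add: vec_eq_iff vector_matrix_mult_def algebra_simps sum_distrib_left)
      then show "a *s x \<in> range (\<lambda>c :: int^'N. c v* B)" by blast
    qed
  qed
  have "\<forall>i. \<exists>c :: int^'N. row i A = c v* B"
    using assms sub by (auto simp: rows_def)
  then obtain f where f: "\<And>i. row i A = f i v* B" by metis
  have "A = (\<chi> i. f i) ** B"
    using f by (simp add: vec_eq_iff row_def vector_matrix_mult_def matrix_matrix_mult_def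
                     mult.commute)
  then show ?thesis by blast
qed

lemma lattice_volume_eq:
  fixes D :: "int^'N^'N"
  assumes "int_vec.span (rows D) = L"
  shows "lattice_volume L = real_of_int \<bar>det D\<bar>"
proof -
  define B :: "int^'N^'N" where "B = (SOME B. int_vec.span (rows B) = L)"
  have B: "int_vec.span (rows B) = L"
    unfolding B_def using assms by (rule someI)
  obtain P where "D = P ** B"
    using span_rows_imp_matrix_mult[of D B] assms B int_vec.span_superset by metis
  moreover obtain Q where "B = Q ** D"
    using span_rows_imp_matrix_mult[of B D] assms B int_vec.span_superset by metis
  ultimately have "det B dvd det D" "det D dvd det B"
    by (metis det_mul dvd_triv_right)+
  then have "\<bar>det B\<bar> = \<bar>det D\<bar>"
    by (metis zdvd_antisym_abs)
  then show ?thesis by (simp add: lattice_volume_def B_def)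
qed

lemma int_ideal_principal:
  fixes I :: "int set"
  assumes "0 \<in> I" "\<And>x y. x \<in> I \<Longrightarrow> y \<in> I \<Longrightarrow> x + y \<in> I" "\<And>c x. x \<in> I \<Longrightarrow> c * x \<in> I"
  shows "\<exists>d\<in>I. \<forall>x\<in>I. d dvd x"
proof (cases "I \<subseteq> {0}")
  case True
  then show ?thesis using assms(1) by auto
next
  case False
  then obtain z where z: "z \<in> I" "z \<noteq> 0" by blast
  have "\<bar>z\<bar> \<in> I" using z assms(3)[of z "sgn z"] by (simp add: sgn_mult_self_eq abs_sgn mult.commute)
  then have ex: "\<exists>m::nat. 0 < m \<and> int m \<in> I"
    using z by (intro exI[of _ "nat \<bar>z\<bar>"]) auto
  define d where "d = (LEAST m::nat. 0 < m \<and> int m \<in> I)"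
  have d: "0 < d" "int d \<in> I" using LeastI_ex[OF ex] by (auto simp: d_def)
  have "int d dvd x" if x: "x \<in> I" for x
  proof (rule ccontr)
    assume "\<not> int d dvd x"
    then have pos: "0 < x mod int d"
      using d(1) by (simp add: dvd_eq_mod_eq_0 order.not_eq_order_implies_strict)
    have "x mod int d = x + (- (x div int d)) * int d"
      by (simp add: minus_div_mult_eq_mod [symmetric])
    then have "x mod int d \<in> I" using assms(2)[OF x assms(3)[OF d(2)]] by metis
    then have "0 < nat (x mod int d) \<and> int (nat (x mod int d)) \<in> I" using pos by simp
    then have "d \<le> nat (x mod int d)" unfolding d_def by (rule Least_le)
    moreover have "x mod int d < int d" using d(1) by simp
    ultimately show False using pos by linarith
  qed
  then show ?thesis using d(2) by blast
qed

lemma lattice_basis_matrix_exists: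
  fixes L :: "(int^'N) set"
  assumes "int_vec.subspace L"
  shows "\<exists>B :: int^'N^'N. int_vec.span (rows B) = L"
proof -
  have "\<exists>f :: 'N \<Rightarrow> int^'N. int_vec.span (f ` S) = L"
    if "finite S" "int_vec.subspace L" "\<forall>x\<in>L. \<forall>i. i \<notin> S \<longrightarrow> x $ i = 0" for S L
    using that
  proof (induction S arbitrary: L rule: finite_induct)
    case empty
    then have "L = {0}" by (auto simp: vec_eq_iff int_vec.subspace_0)
    then show ?case by simp
  next
    case (insert a S)
    note sL = insert.prems(1)
    have "\<exists>d\<in>(\<lambda>x. x $ a) ` L. \<forall>x\<in>(\<lambda>x. x $ a) ` L. d dvd x"
    proof (rule int_ideal_principal)
      show "0 \<in> (\<lambda>x. x $ a) ` L"
        using int_vec.subspace_0[OF sL] by (rule rev_image_eqI) simp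
    next
      fix x y assume "x \<in> (\<lambda>x. x $ a) ` L" "y \<in> (\<lambda>x. x $ a) ` L"
      then obtain u v where "u \<in> L" "v \<in> L" "x = u $ a" "y = v $ a" by blast
      then show "x + y \<in> (\<lambda>x. x $ a) ` L"
        using int_vec.subspace_add[OF sL, of u v] by (intro image_eqI[of _ _ "u + v"]) auto
    next
      fix c x assume "x \<in> (\<lambda>x. x $ a) ` L"
      then obtain u where "u \<in> L" "x = u $ a" by blast
      then show "c * x \<in> (\<lambda>x. x $ a) ` L"
        using int_vec.subspace_scale[OF sL, of u c] by (intro image_eqI[of _ _ "c *s u"]) auto
    qed
    then obtain v where v: "v \<in> L" "\<And>x. x \<in> L \<Longrightarrow> v $ a dvd x $ a" by auto
    define M where "M = {x \<in> L. x $ a = 0}"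
    have "int_vec.subspace M"
      using sL by (auto simp: M_def int_vec.subspace_def)
    moreover have "\<forall>x\<in>M. \<forall>i. i \<notin> S \<longrightarrow> x $ i = 0"
      using insert.prems(2) by (auto simp: M_def)
    ultimately obtain f where f: "int_vec.span (f ` S) = M"
      using insert.IH by blast
    define g where "g = f(a := v)"
    have gi: "g ` insert a S = insert v (f ` S)"
      using insert.hyps by (auto simp: g_def)
    have "int_vec.span (insert v (f ` S)) = L"
    proof
      show "int_vec.span (insert v (f ` S)) \<subseteq> L"
      proof (rule int_vec.span_minimal[OF _ sL])
        show "insert v (f ` S) \<subseteq> L"
          using v f int_vec.span_superset[of "f ` S"] by (auto simp: M_def)
      qed
      show "L \<subseteq> int_vec.span (insert v (f ` S))"
      proof
        fix x assume x: "x \<in> L"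
        obtain m where m: "x $ a = v $ a * m" using v(2)[OF x] by (auto simp: dvd_def)
        have "x - m *s v \<in> M"
          unfolding M_def using x v(1) sL m
          by (simp add: int_vec.subspace_diff int_vec.subspace_scale)
        then show "x \<in> int_vec.span (insert v (f ` S))"
          unfolding int_vec.span_insert f by blast
      qed
    qed
    then show ?case using gi by metis
  qed
  from this[of UNIV L] obtain f :: "'N \<Rightarrow> int^'N" where "int_vec.span (range f) = L"
    using assms by auto
  moreover have "rows (\<chi> i. f i) = range f"
    by (auto simp: rows_def row_def)
  ultimately show ?thesis by metis
qed

section \<open>The approximate frame potential\<close>

definition approx_frame_potential :: "complex^'d \<Rightarrow> ('d \<Rightarrow> int^'N) \<Rightarrow> nat \<Rightarrow> real" where
  "approx_frame_potential \<psi> k t =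
     lattice_volume (walk_lattice k) /
     ((4 * pi * real t) powr (real CARD('N) / 2) *
      sqrt (det (covariance_matrix (freq_pmf \<psi> k))))"

end

theory Submission
  imports Defs
begin

text \<open>
  Raised to the power \<open>t\<close> and averaged over the torus, the trigonometric polynomial with
  frequencies \<open>k x - k y\<close> counts words of length \<open>t\<close> whose frequencies sum to zero. This count
  does not change when the frequencies are expressed in a basis \<open>B\<close> of the lattice they
  generate, which turns the covariance \<open>C\<close> of the new frequencies into \<open>B\<^sup>T C B\<close> and so accounts
  for the volume factor \<open>\<bar>det B\<bar>\<close>. In the new coordinates the polynomial \<open>\<chi>\<close> is nonnegative and
  attains the value 1 on the cube only at the origin, whence \<open>\<chi> x \<le> exp (- c \<bar>x\<bar>\<^sup>2)\<close> there;
  together with \<open>\<chi> x = exp (- Q x) + O(\<bar>x\<bar>\<^sup>4)\<close> this bounds \<open>\<bar>\<chi> x ^ t - exp (- t Q x)\<bar>\<close> by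
  \<open>(E / t) exp (- c t \<bar>x\<bar>\<^sup>2)\<close>, which integrates to the claimed error. The Gaussian integral of
  \<open>exp (- t Q x)\<close> is the main term.
\<close>

section \<open>Gaussian integrals and linear substitutions\<close>

text \<open>Fubini for an integrand that factors over the coordinates. It serves both the Gaussians
  and the characters below.\<close>

lemma has_bochner_integral_lborel_prod:
  fixes f :: "'a::euclidean_space \<Rightarrow> real \<Rightarrow> 'b::{real_normed_field,banach,second_countable_topology}"
  assumes "\<And>b. b \<in> Basis \<Longrightarrow> integrable lborel (f b)"
  shows "has_bochner_integral lborel (\<lambda>x. \<Prod>b\<in>Basis. f b (x \<bullet> b))
    (\<Prod>b\<in>Basis. integral\<^sup>L lborel (f b))"
proof -
  interpret product_sigma_finite "\<lambda>_::'a. lborel :: real measure" ..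
  have m [measurable]: "f b \<in> borel_measurable borel" if "b \<in> Basis" for b
    using assms[OF that] by (auto dest: borel_measurable_integrable)
  have "has_bochner_integral (\<Pi>\<^sub>M b\<in>(Basis::'a set). lborel) (\<lambda>x. \<Prod>b\<in>Basis. f b (x b))
      (\<Prod>b\<in>Basis. integral\<^sup>L lborel (f b))"
    by (simp add: has_bochner_integral_iff product_integral_prod product_integrable_prod assms)
  then show ?thesis
    by (subst lborel_eq)
       (simp add: has_bochner_integral_iff integrable_distr_eq integral_distr cong: prod.cong)
qed

text \<open>
  The library transforms the Lebesgue measure under linear maps only for well-ordered index
  types; \<open>'n idx\<close> is a well-ordered copy of the finite type \<open>'n\<close>.
\<close>

typedef ('n::finite) idx = "{..<CARD('n)}"
  by (rule exI[of _ 0]) simp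

instance idx :: (finite) finite
proof
  show "finite (UNIV :: 'a idx set)"
    by (metis finite_imageI finite_lessThan type_definition.Abs_image type_definition_idx)
qed

instantiation idx :: (finite) wellorder
begin

definition "i \<le> j \<longleftrightarrow> Rep_idx i \<le> Rep_idx j"

definition "i < j \<longleftrightarrow> Rep_idx i < Rep_idx j"

instance
proof
  fix P :: "'a idx \<Rightarrow> bool" and a
  assume step: "\<And>x. (\<And>y. y < x \<Longrightarrow> P y) \<Longrightarrow> P x"
  show "P a"
    by (induction a rule: measure_induct_rule[where f = Rep_idx]) (metis step less_idx_def)
qed (auto simp: less_eq_idx_def less_idx_def Rep_idx_inject)

end

lemma ex_bij_idx: "\<exists>h :: 'n::finite idx \<Rightarrow> 'n. bij h"
proof -
  have "card (UNIV :: 'n idx set) = CARD('n)"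
    by (simp add: type_definition.card[OF type_definition_idx])
  then show ?thesis
    by (metis finite_same_card_bij finite)
qed

text \<open>Transporting permutations along \<open>h\<close> preserves signs and matches the two
  Leibniz sums term by term.\<close>

lemma det_reindex:
  fixes A :: "'a::comm_ring_1^'n^'n" and h :: "'m::finite \<Rightarrow> 'n::finite"
  assumes "bij h"
  shows "det (\<chi> i j. A $ h i $ h j) = det A"
proof -
  have h: "inj h" "surj h"
    using assms by (auto simp: bij_def)
  have "det (\<chi> i j. A $ h i $ h j) = (\<Sum>p | p permutes UNIV. of_int (sign p) * (\<Prod>i\<in>UNIV. A $ h i $ h (p i)))"
    by (simp add: det_def)
  also have "\<dots> = (\<Sum>q | q permutes UNIV. of_int (sign q) * (\<Prod>i\<in>UNIV. A $ i $ q i))"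
  proof (rule sum.reindex_bij_betw[where h = "map_permutation UNIV h", THEN trans[rotated]])
    show "bij_betw (map_permutation UNIV h) {p. p permutes UNIV} {q. q permutes UNIV}"
    proof -
      have "map_permutation UNIV h = (\<lambda>p x. if x \<in> UNIV then h (p (inv h x)) else x)"
        using h by (simp add: map_permutation_def restrict_id_def fun_eq_iff)
      then show ?thesis
        using bij_betw_permutations[OF assms] by simp
    qed
  next
    show "(\<Sum>p | p permutes UNIV. of_int (sign p) * (\<Prod>i\<in>UNIV. A $ h i $ h (p i))) =
      (\<Sum>p | p permutes UNIV. of_int (sign (map_permutation UNIV h p)) * (\<Prod>i\<in>UNIV. A $ i $ map_permutation UNIV h p i))"
    proof (rule sum.cong[OF refl])
      fix p :: "'m \<Rightarrow> 'm" assume "p \<in> {p. p permutes UNIV}"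
      then have p: "p permutes UNIV" by simp
      have "(\<Prod>i\<in>UNIV. A $ i $ map_permutation UNIV h p i) = (\<Prod>i\<in>UNIV. A $ h i $ map_permutation UNIV h p (h i))"
        by (rule prod.reindex_bij_betw[OF assms, symmetric])
      then show "of_int (sign p) * (\<Prod>i\<in>UNIV. A $ h i $ h (p i)) =
         of_int (sign (map_permutation UNIV h p)) * (\<Prod>i\<in>UNIV. A $ i $ map_permutation UNIV h p i)"
        using h p by (simp add: sign_map_permutation map_permutation_apply)
    qed
  qed
  finally show ?thesis by (simp add: det_def)
qed

text \<open>Relabelling coordinates turns boxes into boxes with the same side lengths, and boxes
  determine Lebesgue measure.\<close>

lemma lborel_reindex:
  fixes h :: "'m::finite \<Rightarrow> 'n::finite"
  assumes "bij h"
  shows "distr lborel borel (\<lambda>x. \<chi> i. x $ h i) = (lborel :: (real^'m) measure)"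
proof (rule lborel_eqI[symmetric])
  have m: "(\<lambda>x::real^'n. (\<chi> i. x $ h i) :: real^'m) \<in> borel_measurable borel"
    by (intro borel_measurable_continuous_onI continuous_intros)
  fix l u :: "real^'m" assume lu: "\<And>b. b \<in> Basis \<Longrightarrow> l \<bullet> b \<le> u \<bullet> b"
  have lu': "l $ i \<le> u $ i" for i
    using lu[of "axis i 1"] by (simp add: inner_axis axis_in_Basis_iff)
  define l' u' :: "real^'n" where "l' = (\<chi> j. l $ inv h j)" and "u' = (\<chi> j. u $ inv h j)"
  have bh: "bij (inv h)" using assms by (rule bij_imp_bij_inv)
  have pr: "(\<Prod>b\<in>(Basis::(real^'k) set). (v - w) \<bullet> b) = (\<Prod>i\<in>UNIV. v $ i - w $ i)" for v w :: "real^'k"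
    unfolding Basis_vec_def by (subst prod.UNION_disjoint) (auto simp: axis_eq_axis inner_axis)
  have "(\<lambda>x. \<chi> i. x $ h i) -` box l u = box l' u'"
    using assms by (auto simp: mem_box_cart l'_def u'_def bij_is_inj)
      (metis bij_inv_eq_iff)+
  moreover have "emeasure lborel (box l' u') = (\<Prod>b\<in>Basis. (u' - l') \<bullet> b)"
    using lu' by (intro emeasure_lborel_box) (auto simp: Basis_vec_def inner_axis l'_def u'_def)
  moreover have "(\<Prod>b\<in>Basis. (u' - l') \<bullet> b) = (\<Prod>b\<in>Basis. (u - l) \<bullet> b)"
    unfolding pr l'_def u'_def using prod.reindex_bij_betw[OF bh, of "\<lambda>i. u $ i - l $ i"] by simp
  ultimately show "emeasure (distr lborel borel (\<lambda>x. \<chi> i. x $ h i)) (box l u) = (\<Prod>b\<in>Basis. (u - l) \<bullet> b)"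
    using m by (simp add: emeasure_distr)
qed simp

text \<open>The preimage of a box under \<open>A\<close> is its image under the inverse matrix,
  which divides volumes by \<open>\<bar>det A\<bar>\<close>; the density compensates. As an identity
  of measures this transfers to all integrable functions at once.\<close>

lemma lborel_linear:
  fixes A :: "real^('n::{finite,wellorder})^('n::{finite,wellorder})"
  assumes "det A \<noteq> 0"
  shows "density (distr lborel borel ((*v) A)) (\<lambda>_. ennreal \<bar>det A\<bar>) = lborel"
proof (rule lborel_eqI[symmetric])
  have m: "(*v) A \<in> borel_measurable borel"
    by (intro borel_measurable_continuous_onI linear_continuous_on matrix_vector_mul_bounded_linear)
  obtain B where B: "A ** B = mat 1" "B ** A = mat 1"
    using assms invertible_det_nz[of A] by (auto simp: invertible_def)
  have dB: "\<bar>det A\<bar> * \<bar>det B\<bar> = 1"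
    using B(1) by (metis abs_mult abs_one det_I det_mul)
  fix l u :: "real^('n::{finite,wellorder})" assume lu: "\<And>b. b \<in> Basis \<Longrightarrow> l \<bullet> b \<le> u \<bullet> b"
  have pre: "(*v) A -` box l u = (*v) B ` box l u"
  proof -
    have "A *v (B *v x) = x" "B *v (A *v x) = x" for x
      by (simp_all add: matrix_vector_mul_assoc B)
    then show ?thesis
      by (auto intro!: image_eqI[of _ "(*v) B" "A *v _"])
  qed
  have lm: "(*v) B ` box l u \<in> lmeasurable"
    "measure lebesgue ((*v) B ` box l u) = \<bar>det B\<bar> * measure lebesgue (box l u)"
    using measurable_linear_image[of "(*v) B" "box l u"] measure_linear_image[of "(*v) B" "box l u"] by auto
  have bo: "(*v) B ` box l u \<in> sets borel"
    using measurable_sets[OF m, of "box l u"] by (simp add: pre[symmetric])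
  have "emeasure lborel ((*v) B ` box l u) = ennreal (measure lebesgue ((*v) B ` box l u))"
    using bo emeasure_eq_measure2[OF lm(1)] by simp
  also have "\<dots> = ennreal \<bar>det B\<bar> * (\<Prod>b\<in>Basis. (u - l) \<bullet> b)"
    using lu by (simp add: lm(2) ennreal_mult' measure_lborel_box)
  finally have "emeasure lborel ((*v) A -` box l u) = ennreal \<bar>det B\<bar> * (\<Prod>b\<in>Basis. (u - l) \<bullet> b)"
    by (simp add: pre)
  then show "emeasure (density (distr lborel borel ((*v) A)) (\<lambda>_. ennreal \<bar>det A\<bar>)) (box l u) = (\<Prod>b\<in>Basis. (u - l) \<bullet> b)"
    using m dB by (simp add: emeasure_density nn_integral_cmult emeasure_distr ennreal_mult[symmetric] mult.assoc[symmetric])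
qed simp


lemma has_bochner_integral_linear_wellorder:
  fixes A :: "real^('n::{finite,wellorder})^('n::{finite,wellorder})"
    and g :: "real^('n::{finite,wellorder}) \<Rightarrow> real"
  assumes "det A \<noteq> 0" and g: "has_bochner_integral lborel g I"
  shows "has_bochner_integral lborel (\<lambda>x. g (A *v x)) (I / \<bar>det A\<bar>)"
proof -
  have m [measurable]: "(*v) A \<in> borel_measurable borel"
    by (intro borel_measurable_continuous_onI linear_continuous_on matrix_vector_mul_bounded_linear)
  have [measurable]: "g \<in> borel_measurable borel"
    using g by (auto simp: has_bochner_integral_iff dest: borel_measurable_integrable)
  have "has_bochner_integral (density (distr lborel borel ((*v) A)) (\<lambda>_. ennreal \<bar>det A\<bar>)) g I"
    using g by (simp add: lborel_linear[OF assms(1)])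
  then have "integrable lborel (\<lambda>x. g (A *v x))" "\<bar>det A\<bar> * integral\<^sup>L lborel (\<lambda>x. g (A *v x)) = I"
    using assms(1) by (simp_all add: has_bochner_integral_iff integrable_density integral_density
      integrable_distr_eq integral_distr)
  then show ?thesis
    using assms(1) by (auto simp: has_bochner_integral_iff)
qed

text \<open>The relabelling \<open>R\<close> preserves Lebesgue measure and conjugates
  \<open>A\<close> into a matrix \<open>A'\<close> of the same determinant over the well-ordered
  index type.\<close>

lemma has_bochner_integral_linear:
  fixes A :: "real^'n^'n" and g :: "real^'n \<Rightarrow> real"
  assumes "det A \<noteq> 0" and g: "has_bochner_integral lborel g I"
  shows "has_bochner_integral lborel (\<lambda>x. g (A *v x)) (I / \<bar>det A\<bar>)"
proof -
  obtain h :: "'n idx \<Rightarrow> 'n" where h: "bij h"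
    using ex_bij_idx by blast
  define R :: "real^'n idx \<Rightarrow> real^'n" where "R = (\<lambda>y. \<chi> j. y $ inv h j)"
  have R [measurable]: "R \<in> borel_measurable borel"
    unfolding R_def by (intro borel_measurable_continuous_onI continuous_intros)
  have lR: "distr lborel borel R = lborel"
    unfolding R_def using h by (intro lborel_reindex bij_imp_bij_inv)
  have [measurable]: "g \<in> borel_measurable borel"
    using g by (auto simp: has_bochner_integral_iff dest: borel_measurable_integrable)
  have [measurable]: "(*v) A \<in> borel_measurable borel"
    by (intro borel_measurable_continuous_onI linear_continuous_on matrix_vector_mul_bounded_linear)
  have tr: "has_bochner_integral lborel (\<lambda>y. f (R y)) J \<longleftrightarrow> has_bochner_integral lborel f J"
    if [measurable]: "f \<in> borel_measurable borel" for f :: "real^'n \<Rightarrow> real" and J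
  proof -
    have "has_bochner_integral (distr lborel borel R) f J \<longleftrightarrow> has_bochner_integral lborel (\<lambda>y. f (R y)) J"
      by (simp add: has_bochner_integral_iff integrable_distr_eq integral_distr)
    then show ?thesis by (simp add: lR)
  qed
  define A' :: "real^'n idx^'n idx" where "A' = (\<chi> i j. A $ h i $ h j)"
  have "A *v R y = R (A' *v y)" for y
  proof (simp add: vec_eq_iff R_def A'_def matrix_vector_mult_def, intro allI)
    fix i
    have "(\<Sum>j\<in>UNIV. A $ h (inv h i) $ h j * y $ j) = (\<Sum>j\<in>UNIV. A $ h (inv h i) $ h j * y $ inv h (h j))"
      using h by (simp add: bij_is_inj)
    also have "\<dots> = (\<Sum>j\<in>UNIV. A $ h (inv h i) $ j * y $ inv h j)"
      by (rule sum.reindex_bij_betw[OF h])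
    finally show "(\<Sum>j\<in>UNIV. A $ i $ j * y $ inv h j) = (\<Sum>j\<in>UNIV. A $ h (inv h i) $ h j * y $ j)"
      using h by (simp add: bij_is_surj surj_f_inv_f)
  qed
  moreover have "has_bochner_integral lborel (\<lambda>y. g (R (A' *v y))) (I / \<bar>det A'\<bar>)"
  proof (rule has_bochner_integral_linear_wellorder)
    show "det A' \<noteq> 0" using assms(1) h by (simp add: A'_def det_reindex)
    show "has_bochner_integral lborel (\<lambda>y. g (R y)) I" using g by (simp add: tr)
  qed
  ultimately have "has_bochner_integral lborel (\<lambda>y. g (A *v R y)) (I / \<bar>det A\<bar>)"
    using h by (simp add: A'_def det_reindex)
  then show ?thesis
    by (subst tr[symmetric]) simp_all
qed

section \<open>Gaussian integrals and one-dimensional characters\<close>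

lemma has_bochner_integral_gaussian_real:
  assumes "0 < c"
  shows "has_bochner_integral lborel (\<lambda>x::real. exp (- c * x\<^sup>2)) (sqrt (pi / c))"
proof -
  \<comment> \<open>With this standard deviation the exponent of the normal density is
    \<open>- c * x\<^sup>2\<close>, and its normalising constant is the reciprocal of the claimed
    value.\<close>
  define \<sigma> where "\<sigma> = 1 / sqrt (2 * c)"
  have \<sigma>: "0 < \<sigma>" "2 * \<sigma>\<^sup>2 = 1 / c"
    using assms by (simp_all add: \<sigma>_def power_divide)
  have "has_bochner_integral lborel (\<lambda>x. sqrt (pi / c) * normal_density 0 \<sigma> x) (sqrt (pi / c) * 1)"
    using \<sigma> by (intro has_bochner_integral_mult_right) (simp add: has_bochner_integral_iff)
  moreover have "sqrt (pi / c) * normal_density 0 \<sigma> x = exp (- c * x\<^sup>2)" for x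
  proof -
    have "2 * pi * \<sigma>\<^sup>2 = pi / c" using \<sigma>(2) by (metis mult.assoc mult.commute times_divide_eq_right mult_1_right)
    then show ?thesis
      using assms \<sigma> by (simp add: normal_density_def mult.commute)
  qed
  ultimately show ?thesis by simp
qed

lemma has_bochner_integral_gaussian:
  assumes "0 < c"
  shows "has_bochner_integral lborel (\<lambda>x::'a::euclidean_space. exp (- c * (norm x)\<^sup>2))
    ((pi / c) powr (real DIM('a) / 2))"
proof -
  have "has_bochner_integral lborel (\<lambda>x::'a. \<Prod>b\<in>Basis. exp (- c * (x \<bullet> b)\<^sup>2))
      (\<Prod>b\<in>(Basis::'a set). integral\<^sup>L lborel (\<lambda>x::real. exp (- c * x\<^sup>2)))"
    using has_bochner_integral_gaussian_real[OF assms]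
    by (intro has_bochner_integral_lborel_prod) (simp add: has_bochner_integral_iff)
  moreover have "(\<Prod>b\<in>Basis. exp (- c * (x \<bullet> b)\<^sup>2)) = exp (- c * (norm x)\<^sup>2)" for x :: 'a
  proof -
    have "(norm x)\<^sup>2 = (\<Sum>b\<in>Basis. (x \<bullet> b)\<^sup>2)"
      unfolding power2_norm_eq_inner by (subst euclidean_inner) (simp add: power2_eq_square)
    then show ?thesis
      by (simp add: exp_sum[symmetric] sum_distrib_left)
  qed
  moreover have "(\<Prod>b\<in>(Basis::'a set). integral\<^sup>L lborel (\<lambda>x::real. exp (- c * x\<^sup>2))) =
      (pi / c) powr (real DIM('a) / 2)"
    using assms has_bochner_integral_gaussian_real[OF assms]
    by (simp add: has_bochner_integral_iff powr_half_sqrt[symmetric] powr_powr powr_realpow[symmetric]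
          mult.commute)
  ultimately show ?thesis by simp
qed

text \<open>For \<open>m \<noteq> 0\<close> the antiderivative has period \<open>2 * pi\<close>, so
  its values at the two ends of the interval cancel.\<close>

lemma has_bochner_integral_character_real:
  fixes m :: int
  defines "f \<equiv> \<lambda>x. indicator {-pi..pi} x *\<^sub>R exp (\<i> * of_real (of_int m * x)) :: complex"
  shows "has_bochner_integral lborel f (if m = 0 then of_real (2 * pi) else 0)"
proof (cases "m = 0")
  case True
  have "has_bochner_integral lborel (\<lambda>x. indicator {-pi..pi} x *\<^sub>R (1::complex)) (measure lborel {-pi..pi} *\<^sub>R 1)"
    by (intro has_bochner_integral_indicator) (auto)
  then show ?thesis using True by (simp add: f_def scaleR_conv_of_real)
next
  case False
  define F where "F = (\<lambda>x. exp (\<i> * of_real (of_int m * x)) / (\<i> * of_int m) :: complex)"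
  have "has_bochner_integral lborel (\<lambda>x. indicator {-pi..pi} x *\<^sub>R exp (\<i> * of_real (of_int m * x)) :: complex) (F pi - F (- pi))"
  proof (rule has_bochner_integral_FTC_Icc)
    show "- pi \<le> pi" by simp
    show "(F has_vector_derivative exp (\<i> * of_real (of_int m * x))) (at x within {-pi..pi})" for x
    proof -
      have "((\<lambda>z. exp (\<i> * (of_int m * z)) / (\<i> * of_int m)) has_field_derivative exp (\<i> * (of_int m * of_real x))) (at (of_real x))"
        using False by (auto intro!: derivative_eq_intros simp: mult.left_commute[of \<i> _ \<i>])
      from has_vector_derivative_real_field[OF this] show ?thesis
        by (simp add: F_def has_vector_derivative_at_within)
    qed
    show "continuous_on {- pi..pi} (\<lambda>x. exp (\<i> * of_real (of_int m * x)) :: complex)"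
      by (intro continuous_intros)
  qed
  moreover have "F pi = F (- pi)"
  proof -
    have "exp (\<i> * of_real (of_int m * pi)) = exp (\<i> * of_real (of_int m * (- pi)) + \<i> * (of_int m * (of_real pi * 2)))"
      by (simp add: algebra_simps)
    then show ?thesis
      unfolding F_def exp_plus_2pin by simp
  qed
  ultimately show ?thesis using False by (simp add: f_def)
qed

section \<open>Characters of the torus\<close>

text \<open>Formulated for every Euclidean space, so that the same statements apply to single
  parameters and to pairs of parameters, which form a torus of twice the dimension.\<close>

abbreviation torus_cube :: "'a::euclidean_space set" where
  "torus_cube \<equiv> cbox (- (pi *\<^sub>R One)) (pi *\<^sub>R One)"

lemma mem_torus_cube: "x \<in> torus_cube \<longleftrightarrow> (\<forall>b\<in>Basis. \<bar>x \<bullet> b\<bar> \<le> pi)"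
  by (auto simp: mem_box abs_le_iff)

lemma has_bochner_integral_torus_character:
  fixes m :: "'a::euclidean_space"
  assumes "\<And>b. b \<in> Basis \<Longrightarrow> m \<bullet> b \<in> \<int>"
  shows "has_bochner_integral lborel
    (\<lambda>x. indicator torus_cube x *\<^sub>R exp (\<i> * of_real (m \<bullet> x)) :: complex)
    (if m = 0 then of_real ((2 * pi) ^ DIM('a)) else 0)"
proof -
  \<comment> \<open>The one-dimensional statement takes an integer frequency; the floor recovers it
    from the real coordinate, which is integral by assumption.\<close>
  define f where "f b = (\<lambda>x. indicator {-pi..pi} x *\<^sub>R
      exp (\<i> * of_real (of_int \<lfloor>m \<bullet> b\<rfloor> * x)) :: complex)" for b
  have fl: "of_int \<lfloor>m \<bullet> b\<rfloor> = m \<bullet> b" if "b \<in> Basis" for b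
    using assms[OF that] by simp
  have f: "has_bochner_integral lborel (f b) (if m \<bullet> b = 0 then of_real (2 * pi) else 0)"
    if "b \<in> Basis" for b
  proof -
    have "\<lfloor>m \<bullet> b\<rfloor> = 0 \<longleftrightarrow> m \<bullet> b = 0"
      using fl[OF that] by linarith
    then show ?thesis
      using has_bochner_integral_character_real[of "\<lfloor>m \<bullet> b\<rfloor>"] by (simp only: f_def)
  qed
  have "has_bochner_integral lborel (\<lambda>x. \<Prod>b\<in>Basis. f b (x \<bullet> b))
      (\<Prod>b\<in>Basis. integral\<^sup>L lborel (f b))"
    using f by (intro has_bochner_integral_lborel_prod) (auto simp: has_bochner_integral_iff)
  moreover have "(\<Prod>b\<in>Basis. f b (x \<bullet> b)) =
      indicator torus_cube x *\<^sub>R exp (\<i> * of_real (m \<bullet> x))" for x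
  proof (cases "x \<in> torus_cube")
    case True
    then have "(\<Prod>b\<in>Basis. f b (x \<bullet> b)) = (\<Prod>b\<in>Basis. exp (\<i> * of_real ((m \<bullet> b) * (x \<bullet> b))))"
      by (intro prod.cong refl) (auto simp: f_def fl mem_torus_cube abs_le_iff indicator_def)
    also have "\<dots> = exp (\<i> * of_real (m \<bullet> x))"
      by (subst euclidean_inner[of m x])
         (simp add: exp_sum[symmetric] sum_distrib_left)
    finally show ?thesis using True by simp
  next
    case False
    then obtain b where b: "b \<in> Basis" "\<not> \<bar>x \<bullet> b\<bar> \<le> pi"
      unfolding mem_torus_cube by blast
    then have "f b (x \<bullet> b) = 0" by (auto simp: f_def indicator_def)
    then show ?thesis using b(1) False by auto
  qed
  moreover have "(\<Prod>b\<in>Basis. integral\<^sup>L lborel (f b)) =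
      (if m = 0 then of_real ((2 * pi) ^ DIM('a)) else 0)"
  proof -
    have "(\<Prod>b\<in>Basis. integral\<^sup>L lborel (f b)) =
        (\<Prod>b\<in>Basis. if m \<bullet> b = 0 then of_real (2 * pi) else 0)"
      using f by (intro prod.cong refl) (auto simp: has_bochner_integral_iff)
    also have "\<dots> = (if m = 0 then of_real ((2 * pi) ^ DIM('a)) else 0)"
    proof (cases "m = 0")
      case False
      then obtain b where "b \<in> Basis" "m \<bullet> b \<noteq> 0"
        using euclidean_eqI[of m 0] by auto
      then show ?thesis using False by (intro trans[OF prod_zero]) auto
    qed simp
    finally show ?thesis .
  qed
  ultimately show ?thesis by simp
qed

text \<open>Multiplying out the power gives one character for each word \<open>g\<close> of length
  \<open>t\<close>; orthogonality keeps exactly the words whose frequencies sum to zero.\<close>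

lemma has_bochner_integral_torus_power:
  fixes m :: "'i \<Rightarrow> 'a::euclidean_space" and c :: "'i \<Rightarrow> complex"
  assumes fin: "finite I" and int: "\<And>i b. i \<in> I \<Longrightarrow> b \<in> Basis \<Longrightarrow> m i \<bullet> b \<in> \<int>"
  shows "has_bochner_integral lborel
    (\<lambda>x. indicator torus_cube x *\<^sub>R (\<Sum>i\<in>I. c i * exp (\<i> * of_real (m i \<bullet> x))) ^ t)
    (of_real ((2 * pi) ^ DIM('a)) *
      (\<Sum>g | g \<in> {..<t} \<rightarrow>\<^sub>E I \<and> (\<Sum>s<t. m (g s)) = 0. \<Prod>s<t. c (g s)))"
proof -
  define W where "W = ({..<t} \<rightarrow>\<^sub>E I)"
  have W: "finite W" unfolding W_def using fin by (intro finite_PiE) auto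
  have pow: "(\<Sum>i\<in>I. c i * exp (\<i> * of_real (m i \<bullet> x))) ^ t =
      (\<Sum>g\<in>W. (\<Prod>s<t. c (g s)) * exp (\<i> * of_real ((\<Sum>s<t. m (g s)) \<bullet> x)))" for x
  proof -
    have "(\<Sum>i\<in>I. c i * exp (\<i> * of_real (m i \<bullet> x))) ^ t =
        (\<Prod>s<t. \<Sum>i\<in>I. c i * exp (\<i> * of_real (m i \<bullet> x)))"
      by simp
    also have "\<dots> = (\<Sum>g\<in>W. \<Prod>s<t. c (g s) * exp (\<i> * of_real (m (g s) \<bullet> x)))"
      unfolding W_def using fin by (intro prod_sum_PiE) auto
    finally show ?thesis
      by (simp add: prod.distrib exp_sum[symmetric] inner_sum_left sum_distrib_left)
  qed
  have "has_bochner_integral lborel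
    (\<lambda>x. \<Sum>g\<in>W. (\<Prod>s<t. c (g s)) * (indicator torus_cube x *\<^sub>R exp (\<i> * of_real ((\<Sum>s<t. m (g s)) \<bullet> x))))
    (\<Sum>g\<in>W. (\<Prod>s<t. c (g s)) * (if (\<Sum>s<t. m (g s)) = 0 then of_real ((2 * pi) ^ DIM('a)) else 0))"
  proof (intro has_bochner_integral_sum has_bochner_integral_mult_right has_bochner_integral_torus_character)
    fix g and b :: 'a assume "g \<in> W" "b \<in> Basis"
    then show "(\<Sum>s<t. m (g s)) \<bullet> b \<in> \<int>"
      unfolding inner_sum_left by (intro Ints_sum int) (auto simp: W_def)
  qed
  moreover have "(\<Sum>g\<in>W. (\<Prod>s<t. c (g s)) * (if (\<Sum>s<t. m (g s)) = 0 then of_real ((2 * pi) ^ DIM('a)) else 0)) =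
      of_real ((2 * pi) ^ DIM('a)) * (\<Sum>g | g \<in> W \<and> (\<Sum>s<t. m (g s)) = 0. \<Prod>s<t. c (g s))"
    using W by (simp add: sum_distrib_left sum.inter_filter[symmetric] if_distrib mult.commute cong: if_cong)
  ultimately show ?thesis
    by (simp add: pow scaleR_sum_right scaleR_conv_of_real sum_distrib_left mult_ac W_def)
qed

text \<open>
  The torus average of a power of a trigonometric polynomial counts the closed words in its
  frequencies, so it only depends on which sums of frequencies vanish.
\<close>

lemma torus_average_cong:
  fixes m :: "'i::finite \<Rightarrow> 'a::euclidean_space" and m' :: "'i \<Rightarrow> 'b::euclidean_space"
    and c :: "'i \<Rightarrow> complex" and f :: "'a \<Rightarrow> real" and f' :: "'b \<Rightarrow> real"
  assumes int: "\<And>i b. b \<in> Basis \<Longrightarrow> m i \<bullet> b \<in> \<int>"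
    and int': "\<And>i b. b \<in> Basis \<Longrightarrow> m' i \<bullet> b \<in> \<int>"
    and f: "\<And>x. of_real (f x) = (\<Sum>i\<in>UNIV. c i * exp (\<i> * of_real (m i \<bullet> x)))"
    and f': "\<And>x. of_real (f' x) = (\<Sum>i\<in>UNIV. c i * exp (\<i> * of_real (m' i \<bullet> x)))"
    and closed: "\<And>g. (\<Sum>s<t. m (g s)) = 0 \<longleftrightarrow> (\<Sum>s<t. m' (g s)) = 0"
  shows "(LINT x : torus_cube | lborel. f x ^ t) / (2 * pi) ^ DIM('a) =
    (LINT x : torus_cube | lborel. f' x ^ t) / (2 * pi) ^ DIM('b)"
proof -
  define S where "S = (\<Sum>g | g \<in> {..<t} \<rightarrow>\<^sub>E UNIV \<and> (\<Sum>s<t. m (g s)) = 0. \<Prod>s<t. c (g s))"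
  \<comment> \<open>Stated for an arbitrary space, since the two polynomials may live in different
    dimensions. Once \<open>closed\<close> identifies the index sets, both integrals contain the
    same sum \<open>S\<close>.\<close>
  have aux: "(of_real (LINT x : torus_cube | lborel. f x ^ t) :: complex) =
      of_real ((2 * pi) ^ DIM('e)) *
      (\<Sum>g | g \<in> {..<t} \<rightarrow>\<^sub>E UNIV \<and> (\<Sum>s<t. m (g s)) = 0. \<Prod>s<t. c (g s))"
    if int: "\<And>i b. b \<in> Basis \<Longrightarrow> m i \<bullet> b \<in> \<int>"
      and f: "\<And>x. of_real (f x) = (\<Sum>i\<in>UNIV. c i * exp (\<i> * of_real (m i \<bullet> x)))"
    for m :: "'i \<Rightarrow> 'e::euclidean_space" and f
  proof -
    have "(of_real (LINT x : torus_cube | lborel. f x ^ t) :: complex) =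
        (LINT x | lborel. indicator torus_cube x *\<^sub>R of_real (f x) ^ t)"
      unfolding set_lebesgue_integral_def
      by (subst integral_complex_of_real[symmetric]) (simp add: scaleR_conv_of_real)
    then show ?thesis
      unfolding f
      using has_bochner_integral_torus_power[of UNIV m c t] int
      by (simp add: has_bochner_integral_iff)
  qed
  have "(of_real (LINT x : torus_cube | lborel. f x ^ t) :: complex) = of_real ((2 * pi) ^ DIM('a)) * S"
    unfolding S_def by (rule aux[OF int f])
  moreover have "(of_real (LINT x : torus_cube | lborel. f' x ^ t) :: complex) = of_real ((2 * pi) ^ DIM('b)) * S"
    unfolding S_def closed by (rule aux[OF int' f'])
  ultimately have "(of_real ((LINT x : torus_cube | lborel. f x ^ t) / (2 * pi) ^ DIM('a)) :: complex) =
     of_real ((LINT x : torus_cube | lborel. f' x ^ t) / (2 * pi) ^ DIM('b))"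
    by simp
  then show ?thesis
    by (simp only: of_real_eq_iff)
qed

section \<open>Local expansion of the characteristic function\<close>

text \<open>Telescoping: one factor contributes the difference and the other \<open>n\<close> are
  bounded by \<open>w\<close>. Keeping \<open>w ^ n\<close> matters, because it later carries the
  Gaussian decay.\<close>

lemma abs_power_diff_le:
  fixes u v w :: real
  assumes "0 \<le> u" "u \<le> w" "0 \<le> v" "v \<le> w"
  shows "\<bar>u ^ Suc n - v ^ Suc n\<bar> \<le> real (Suc n) * \<bar>u - v\<bar> * w ^ n"
proof (induction n)
  case (Suc n)
  have w: "0 \<le> w" using assms by simp
  have "u ^ Suc (Suc n) - v ^ Suc (Suc n) = u * (u ^ Suc n - v ^ Suc n) + (u - v) * v ^ Suc n"
    by (simp add: algebra_simps)
  then have "\<bar>u ^ Suc (Suc n) - v ^ Suc (Suc n)\<bar> \<le> u * \<bar>u ^ Suc n - v ^ Suc n\<bar> + \<bar>u - v\<bar> * v ^ Suc n"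
    using assms abs_triangle_ineq[of "u * (u ^ Suc n - v ^ Suc n)" "(u - v) * v ^ Suc n"]
    by (simp add: abs_mult)
  also have "\<dots> \<le> w * (real (Suc n) * \<bar>u - v\<bar> * w ^ n) + \<bar>u - v\<bar> * w ^ Suc n"
    using assms w Suc by (intro add_mono mult_mono mult_left_mono power_mono) auto
  also have "\<dots> = real (Suc (Suc n)) * \<bar>u - v\<bar> * w ^ Suc n"
    by (simp add: algebra_simps)
  finally show ?case .
qed simp

lemma abs_exp_minus_linear_le:
  fixes s :: real
  assumes "0 \<le> s"
  shows "\<bar>exp (- s) - (1 - s)\<bar> \<le> s\<^sup>2"
proof -
  \<comment> \<open>The upper bound comes from comparing this with
    \<open>(1 + s) * (1 - s + s\<^sup>2) = 1 + s ^ 3\<close> and cancelling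
    \<open>1 + s\<close>.\<close>
  have "(1 + s) * exp (- s) \<le> 1"
    using exp_ge_add_one_self[of s] by (simp add: exp_minus field_simps)
  also have "1 \<le> (1 + s) * (1 - s + s\<^sup>2)"
    using assms by (simp add: algebra_simps power2_eq_square)
  finally have "exp (- s) \<le> 1 - s + s\<^sup>2"
    using assms by (simp add: mult_le_cancel_left)
  then show ?thesis
    using exp_ge_add_one_self[of "- s"] by simp
qed

lemma abs_cos_minus_quadratic_le:
  fixes u :: real
  shows "\<bar>cos u - (1 - u\<^sup>2 / 2)\<bar> \<le> u ^ 4 / 24"
proof -
  obtain r where "cos u = (\<Sum>m<4. cos_coeff m * u ^ m) + (cos (r + 1/2 * real 4 * pi) / fact 4) * u ^ 4"
    using Maclaurin_cos_expansion[of u 4] by blast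
  moreover have "{..<4} = {0, 1, 2, 3 :: nat}"
    by auto
  ultimately have eq: "cos u - (1 - u\<^sup>2 / 2) = cos (r + 1/2 * real 4 * pi) * (u ^ 4 / 24)"
    by (simp add: cos_coeff_def fact_numeral)
  have "\<bar>cos u - (1 - u\<^sup>2 / 2)\<bar> = \<bar>cos (r + 1/2 * real 4 * pi)\<bar> * (u ^ 4 / 24)"
    unfolding eq abs_mult by simp
  also have "\<dots> \<le> 1 * (u ^ 4 / 24)"
    by (intro mult_right_mono) auto
  finally show ?thesis by simp
qed

text \<open>The minimum of \<open>Q\<close> on the unit sphere is positive by compactness, and
  homogeneity extends the bound to all vectors.\<close>

lemma positive_quadratic_ge_norm:
  fixes Q :: "'a::euclidean_space \<Rightarrow> real"
  assumes cont: "continuous_on UNIV Q" and hom: "\<And>r x. Q (r *\<^sub>R x) = r\<^sup>2 * Q x"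
    and pos: "\<And>x. x \<noteq> 0 \<Longrightarrow> 0 < Q x"
  obtains a where "0 < a" "\<And>x. a * (norm x)\<^sup>2 \<le> Q x"
proof -
  have "sphere (0::'a) 1 \<noteq> {}"
    by simp
  moreover have "continuous_on (sphere 0 1) Q"
    using cont continuous_on_subset by blast
  ultimately obtain y where y: "y \<in> sphere 0 1" "\<And>x. x \<in> sphere 0 1 \<Longrightarrow> Q y \<le> Q x"
    using continuous_attains_inf[OF compact_sphere] by metis
  have "Q y * (norm x)\<^sup>2 \<le> Q x" for x
  proof (cases "x = 0")
    case True
    then show ?thesis using hom[of 0 x] by simp
  next
    case False
    then have "Q y \<le> Q (inverse (norm x) *\<^sub>R x)"
      by (intro y) simp
    then show ?thesis
      using False by (simp add: hom power_inverse field_simps)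
  qed
  moreover have "0 < Q y" using y(1) by (intro pos) auto
  ultimately show thesis using that by blast
qed

text \<open>The real part of the characteristic function of a random vector with value
  \<open>d i\<close> with probability \<open>q i\<close>. For a symmetric vector, such as a
  difference of two independent copies, it is the whole characteristic function.\<close>

definition charfun :: "('i::finite \<Rightarrow> real) \<Rightarrow> ('i \<Rightarrow> 'a::euclidean_space) \<Rightarrow> 'a \<Rightarrow> real" where
  "charfun q d x = (\<Sum>i\<in>UNIV. q i * cos (d i \<bullet> x))"

text \<open>The quadratic term that \<open>charfun\<close> loses at the origin; half the variance of
  the projection to \<open>x\<close> when the vector is centred.\<close>

definition half_variance :: "('i::finite \<Rightarrow> real) \<Rightarrow> ('i \<Rightarrow> 'a::euclidean_space) \<Rightarrow> 'a \<Rightarrow> real" where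
  "half_variance q d x = (\<Sum>i\<in>UNIV. q i * (d i \<bullet> x)\<^sup>2) / 2"

context
  fixes q :: "'i::finite \<Rightarrow> real" and d :: "'i \<Rightarrow> 'a::euclidean_space"
  assumes q_nonneg: "\<And>i. 0 \<le> q i" and q_sum: "(\<Sum>i\<in>UNIV. q i) = 1"
begin

lemma half_variance_nonneg: "0 \<le> half_variance q d x"
  unfolding half_variance_def by (simp add: q_nonneg sum_nonneg)

text \<open>The cosine has no cubic term, and \<open>exp (- s)\<close> differs from
  \<open>1 - s\<close> by at most \<open>s\<^sup>2\<close>, which is quartic because
  \<open>s\<close> is quadratic in \<open>x\<close>. The first estimate serves to bound
  \<open>charfun\<close> near the origin, the second to compare powers.\<close>

lemma charfun_quartic:
  obtains M where "0 < M" "\<And>x. \<bar>charfun q d x - (1 - half_variance q d x)\<bar> \<le> M * norm x ^ 4"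
    "\<And>x. \<bar>charfun q d x - exp (- half_variance q d x)\<bar> \<le> M * norm x ^ 4"
proof -
  define D where "D = (\<Sum>i\<in>UNIV. norm (d i))"
  have dx: "\<bar>d i \<bullet> x\<bar> \<le> D * norm x" for i x
  proof -
    have "norm (d i) \<le> D"
      unfolding D_def by (rule member_le_sum) auto
    then show ?thesis
      using Cauchy_Schwarz_ineq2[of "d i" x] by (meson mult_right_mono norm_ge_zero order_trans)
  qed
  have D0: "0 \<le> D" by (simp add: D_def sum_nonneg)
  have a: "\<bar>charfun q d x - (1 - half_variance q d x)\<bar> \<le> D ^ 4 / 24 * norm x ^ 4" for x
  proof -
    have "charfun q d x - (1 - half_variance q d x) = (\<Sum>i\<in>UNIV. q i * (cos (d i \<bullet> x) - (1 - (d i \<bullet> x)\<^sup>2 / 2)))"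
      by (simp add: charfun_def half_variance_def right_diff_distrib sum_subtractf q_sum
          sum_divide_distrib sum.distrib algebra_simps)
    also have "\<bar>\<dots>\<bar> \<le> (\<Sum>i\<in>UNIV. q i * ((D * norm x) ^ 4 / 24))"
    proof (rule order_trans[OF sum_abs sum_mono])
      fix i
      have "\<bar>cos (d i \<bullet> x) - (1 - (d i \<bullet> x)\<^sup>2 / 2)\<bar> \<le> (d i \<bullet> x) ^ 4 / 24"
        by (rule abs_cos_minus_quadratic_le)
      also have "\<dots> \<le> (D * norm x) ^ 4 / 24"
        using power_mono[OF dx[of i x], of 4] by simp
      finally show "\<bar>q i * (cos (d i \<bullet> x) - (1 - (d i \<bullet> x)\<^sup>2 / 2))\<bar> \<le> q i * ((D * norm x) ^ 4 / 24)"
        unfolding abs_mult abs_of_nonneg[OF q_nonneg] by (rule mult_left_mono[OF _ q_nonneg])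
    qed
    also have "\<dots> = D ^ 4 / 24 * norm x ^ 4"
      unfolding sum_distrib_right[symmetric] q_sum by (simp add: power_mult_distrib)
    finally show ?thesis .
  qed
  have b: "half_variance q d x \<le> D\<^sup>2 * (norm x)\<^sup>2 / 2" for x
  proof -
    have "(\<Sum>i\<in>UNIV. q i * (d i \<bullet> x)\<^sup>2) \<le> (\<Sum>i\<in>UNIV. q i * (D * norm x)\<^sup>2)"
    proof (intro sum_mono mult_left_mono q_nonneg)
      show "(d i \<bullet> x)\<^sup>2 \<le> (D * norm x)\<^sup>2" for i
        using power_mono[OF dx[of i x], of 2] by simp
    qed
    also have "\<dots> = D\<^sup>2 * (norm x)\<^sup>2"
      by (simp add: sum_distrib_right[symmetric] q_sum power_mult_distrib)
    finally show ?thesis by (simp add: half_variance_def)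
  qed
  have c: "\<bar>exp (- half_variance q d x) - (1 - half_variance q d x)\<bar> \<le> D ^ 4 / 4 * norm x ^ 4" for x
  proof -
    have "(half_variance q d x)\<^sup>2 \<le> (D\<^sup>2 * (norm x)\<^sup>2 / 2)\<^sup>2"
      using b half_variance_nonneg by (intro power_mono)
    also have "\<dots> = D ^ 4 / 4 * norm x ^ 4"
      by (simp add: power_divide power_mult_distrib flip: power_mult)
    finally show ?thesis
      using abs_exp_minus_linear_le[OF half_variance_nonneg, of x] by linarith
  qed
  \<comment> \<open>One constant serves both estimates; its summand 1 keeps it positive even if all
    \<open>d i\<close> vanish.\<close>
  have m: "D ^ 4 / 24 * norm x ^ 4 + D ^ 4 / 4 * norm x ^ 4 \<le> (D ^ 4 + 1) * norm x ^ 4" for x :: 'a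
  proof -
    have "(D ^ 4 / 24 + D ^ 4 / 4) * norm x ^ 4 \<le> (D ^ 4 + 1) * norm x ^ 4"
      by (intro mult_right_mono) auto
    then show ?thesis by (simp add: distrib_right)
  qed
  have p: "0 \<le> D ^ 4 / 4 * norm x ^ 4" "0 \<le> D ^ 4 / 24 * norm x ^ 4" for x :: 'a by auto
  show thesis
  proof
    show "0 < D ^ 4 + 1" by (simp add: add_nonneg_pos)
    show "\<bar>charfun q d x - (1 - half_variance q d x)\<bar> \<le> (D ^ 4 + 1) * norm x ^ 4" for x
      using a[of x] m[of x] p[of x] by linarith
    show "\<bar>charfun q d x - exp (- half_variance q d x)\<bar> \<le> (D ^ 4 + 1) * norm x ^ 4" for x
      using a[of x] c[of x] m[of x] by linarith
  qed
qed

text \<open>Near the origin the quadratic term dominates the quartic error. On the rest of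
  \<open>K\<close>, aperiodicity and compactness keep \<open>charfun\<close> below 1 by a fixed gap.
  Both cases bound \<open>1 - charfun q d x\<close> below by \<open>c * (norm x)\<^sup>2\<close>,
  and \<open>1 - s \<le> exp (- s)\<close> finishes.\<close>

lemma charfun_subgaussian:
  assumes pos: "\<And>x. x \<noteq> 0 \<Longrightarrow> 0 < half_variance q d x"
    and aper: "\<And>x. x \<in> K \<Longrightarrow> (\<And>i. 0 < q i \<Longrightarrow> cos (d i \<bullet> x) = 1) \<Longrightarrow> x = 0"
    and K: "compact K"
  obtains c where "0 < c" "\<And>x. c * (norm x)\<^sup>2 \<le> half_variance q d x"
    "\<And>x. x \<in> K \<Longrightarrow> charfun q d x \<le> exp (- c * (norm x)\<^sup>2)"
proof -
  obtain a where a: "0 < a" "\<And>x. a * (norm x)\<^sup>2 \<le> half_variance q d x"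
  proof (rule positive_quadratic_ge_norm[of "half_variance q d"])
    show "continuous_on UNIV (half_variance q d)"
      unfolding half_variance_def by (intro continuous_intros) simp
    show "half_variance q d (r *\<^sub>R x) = r\<^sup>2 * half_variance q d x" for r x
      by (simp add: half_variance_def power_mult_distrib sum_distrib_left mult_ac)
  qed (use pos in auto)
  obtain M where M: "0 < M" "\<And>x. \<bar>charfun q d x - (1 - half_variance q d x)\<bar> \<le> M * norm x ^ 4"
    using charfun_quartic by metis
  \<comment> \<open>Within this radius the quartic error uses up at most half of the lower bound
    \<open>a * (norm x)\<^sup>2\<close>.\<close>
  define \<delta> where "\<delta> = sqrt (a / (2 * M))"
  have \<delta>: "0 < \<delta>" "\<delta>\<^sup>2 = a / (2 * M)"
    using a M by (simp_all add: \<delta>_def)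
  have near: "a / 2 * (norm x)\<^sup>2 \<le> 1 - charfun q d x" if "norm x \<le> \<delta>" for x
  proof -
    have "(norm x)\<^sup>2 \<le> a / (2 * M)"
      using that \<delta> power_mono[of "norm x" \<delta> 2] by simp
    then have "M * (norm x)\<^sup>2 \<le> a / 2" using M by (simp add: field_simps)
    then have "M * (norm x)\<^sup>2 * (norm x)\<^sup>2 \<le> a / 2 * (norm x)\<^sup>2"
      by (rule mult_right_mono) simp
    then have "M * norm x ^ 4 \<le> a / 2 * (norm x)\<^sup>2"
      by (simp add: mult.assoc flip: power_add)
    then show ?thesis using M(2)[of x] a(2)[of x] by (simp add: abs_le_iff)
  qed
  define L where "L = K - ball 0 \<delta>"
  have "compact L" unfolding L_def using K by (intro compact_diff) auto
  have cpos: "0 < 1 - charfun q d x" if "x \<in> L" for x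
  proof -
    have nz: "x \<noteq> 0" using that \<delta> by (auto simp: L_def)
    \<comment> \<open>All terms are nonnegative, so the value 1 forces every cosine of positive
      weight to be 1, which aperiodicity allows only at the origin.\<close>
    have sm: "1 - charfun q d x = (\<Sum>i\<in>UNIV. q i * (1 - cos (d i \<bullet> x)))"
      by (simp add: charfun_def right_diff_distrib sum_subtractf q_sum)
    have "1 - charfun q d x \<noteq> 0"
    proof
      assume "1 - charfun q d x = 0"
      then have "\<forall>i\<in>UNIV. q i * (1 - cos (d i \<bullet> x)) = 0"
        unfolding sm using q_nonneg by (subst (asm) sum_nonneg_eq_0_iff) auto
      then have z: "q i * (1 - cos (d i \<bullet> x)) = 0" for i
        by blast
      have "cos (d i \<bullet> x) = 1" if "0 < q i" for i
        using z[of i] that by simp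
      then have "x = 0"
        using \<open>x \<in> L\<close> by (intro aper) (auto simp: L_def)
      then show False using nz by simp
    qed
    moreover have "0 \<le> 1 - charfun q d x"
      unfolding sm using q_nonneg by (intro sum_nonneg) auto
    ultimately show ?thesis by simp
  qed
  obtain \<epsilon> where e: "0 < \<epsilon>" "\<And>x. x \<in> L \<Longrightarrow> \<epsilon> \<le> 1 - charfun q d x"
  proof (cases "L = {}")
    case True
    then show ?thesis using that[of 1] by simp
  next
    case False
    have "continuous_on L (\<lambda>x. 1 - charfun q d x)"
      unfolding charfun_def by (intro continuous_intros)
    then obtain y where "y \<in> L" "\<And>x. x \<in> L \<Longrightarrow> 1 - charfun q d y \<le> 1 - charfun q d x"
      using continuous_attains_inf[OF \<open>compact L\<close> False] by metis
    then show ?thesis using that[of "1 - charfun q d y"] cpos by blast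
  qed
  obtain R where R: "0 < R" "\<And>x. x \<in> K \<Longrightarrow> norm x \<le> R"
    using compact_imp_bounded[OF K] by (auto simp: bounded_pos)
  \<comment> \<open>The first entry is the rate inside radius \<open>\<delta>\<close>. The second
    spreads the gap \<open>\<epsilon>\<close> over \<open>K\<close>, where
    \<open>norm x \<le> R\<close>.\<close>
  define c where "c = min (a / 2) (\<epsilon> / R\<^sup>2)"
  have c: "0 < c" "c \<le> a / 2" "c \<le> \<epsilon> / R\<^sup>2" 
    using a e R min.cobounded1[of "a / 2" "\<epsilon> / R\<^sup>2"] min.cobounded2[of "a / 2" "\<epsilon> / R\<^sup>2"]
    by (simp_all only: c_def) simp
  show thesis
  proof
    show "0 < c" by fact
    show "c * (norm x)\<^sup>2 \<le> half_variance q d x" for x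
    proof -
      have "c * (norm x)\<^sup>2 \<le> a * (norm x)\<^sup>2" using c a by (intro mult_right_mono) auto
      then show ?thesis using a(2)[of x] by linarith
    qed
    show "charfun q d x \<le> exp (- c * (norm x)\<^sup>2)" if x: "x \<in> K" for x
    proof -
      have "c * (norm x)\<^sup>2 \<le> 1 - charfun q d x"
      proof (cases "norm x \<le> \<delta>")
        case True
        have "c * (norm x)\<^sup>2 \<le> a / 2 * (norm x)\<^sup>2" using c by (intro mult_right_mono) auto
        then show ?thesis using near[OF True] by linarith
      next
        case False
        then have "x \<in> L" using x by (simp add: L_def)
        have "c * (norm x)\<^sup>2 \<le> \<epsilon> / R\<^sup>2 * R\<^sup>2"
          using c e R(2)[OF x] by (intro mult_mono power_mono) auto
        also have "\<dots> = \<epsilon>" using R by simp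
        finally show ?thesis using e(2)[OF \<open>x \<in> L\<close>] by linarith
      qed
      then show ?thesis using exp_ge_add_one_self[of "- c * (norm x)\<^sup>2"] by simp
    qed
  qed
qed

text \<open>Telescoping bounds the difference by a multiple of \<open>t * norm x ^ 4\<close> times a
  Gaussian; giving up half of its exponent turns that factor into \<open>1 / t\<close>.
  Nonnegativity rules out values near -1, whose powers would not decay.\<close>

lemma charfun_power_approx:
  assumes nonneg: "\<And>x. 0 \<le> charfun q d x"
    and pos: "\<And>x. x \<noteq> 0 \<Longrightarrow> 0 < half_variance q d x"
    and aper: "\<And>x. x \<in> K \<Longrightarrow> (\<And>i. 0 < q i \<Longrightarrow> cos (d i \<bullet> x) = 1) \<Longrightarrow> x = 0"
    and K: "compact K" and ball: "ball 0 1 \<subseteq> K"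
  obtains c E where "0 < c" "0 < E"
    "\<And>x t. 0 < t \<Longrightarrow> \<bar>indicator K x * charfun q d x ^ t - exp (- real t * half_variance q d x)\<bar>
      \<le> E / real t * exp (- (c * real t) * (norm x)\<^sup>2)"
proof -
  obtain c where c: "0 < c" "\<And>x. c * (norm x)\<^sup>2 \<le> half_variance q d x"
    "\<And>x. x \<in> K \<Longrightarrow> charfun q d x \<le> exp (- c * (norm x)\<^sup>2)"
    using charfun_subgaussian[OF pos aper K] by metis
  obtain M where M: "0 < M" "\<And>x. \<bar>charfun q d x - exp (- half_variance q d x)\<bar> \<le> M * norm x ^ 4"
    using charfun_quartic by metis
  obtain R where R: "0 < R" "\<And>x. x \<in> K \<Longrightarrow> norm x \<le> R"
    using compact_imp_bounded[OF K] by (auto simp: bounded_pos)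
  \<comment> \<open>Telescoping leaves the exponent \<open>t - 1\<close> in place of
    \<open>t\<close>, at a cost of at most \<open>exp (c * R\<^sup>2)\<close> on \<open>K\<close>.
    The summand 1 ensures \<open>1 \<le> M'\<close> for the points outside \<open>K\<close>.\<close>
  define M' where "M' = M * exp (c * R\<^sup>2) + 1"
  have M': "M * exp (c * R\<^sup>2) \<le> M'" "1 \<le> M'" using M by (auto simp: M'_def)
  have main: "\<bar>indicator K x * charfun q d x ^ t - exp (- real t * half_variance q d x)\<bar>
      \<le> real t * M' * norm x ^ 4 * exp (- (c * real t * (norm x)\<^sup>2))" if "0 < t" for x t
  proof (cases "x \<in> K")
    case True
    obtain n where t: "t = Suc n" using \<open>0 < t\<close> by (cases t) auto
    have "\<bar>charfun q d x ^ Suc n - exp (- half_variance q d x) ^ Suc n\<bar> \<le>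
        real (Suc n) * \<bar>charfun q d x - exp (- half_variance q d x)\<bar> * exp (- c * (norm x)\<^sup>2) ^ n"
      using nonneg c(2)[of x] c(3)[OF True] by (intro abs_power_diff_le) auto
    also have "exp (- c * (norm x)\<^sup>2) ^ n = exp (c * (norm x)\<^sup>2) * exp (- (c * real t * (norm x)\<^sup>2))"
      by (simp add: t exp_of_nat_mult[symmetric] exp_add[symmetric] algebra_simps)
    also have "real (Suc n) * \<bar>charfun q d x - exp (- half_variance q d x)\<bar> * \<dots> \<le>
        real (Suc n) * (M * norm x ^ 4) * (exp (c * R\<^sup>2) * exp (- (c * real t * (norm x)\<^sup>2)))"
      using M R(1) R(2)[OF True] c by (intro mult_mono mult_left_mono mult_right_mono) (auto intro!: power_mono)
    also have "\<dots> = real t * (M * exp (c * R\<^sup>2)) * norm x ^ 4 * exp (- (c * real t * (norm x)\<^sup>2))"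
      by (simp add: t mult_ac)
    also have "\<dots> \<le> real t * M' * norm x ^ 4 * exp (- (c * real t * (norm x)\<^sup>2))"
      using M' by (intro mult_right_mono mult_left_mono) auto
    also have "exp (- half_variance q d x) ^ Suc n = exp (- real t * half_variance q d x)"
      unfolding t by (subst exp_of_nat_mult[symmetric]) (simp add: algebra_simps)
    finally show ?thesis using True t by simp
  next
    case False
    \<comment> \<open>Outside \<open>K\<close> only the Gaussian remains. There the polynomial
      factor of the bound is at least 1, so the decay of the Gaussian alone suffices.\<close>
    then have x1: "1 \<le> norm x" using ball by (force simp: subset_iff)
    have "exp (- real t * half_variance q d x) \<le> exp (- (c * real t * (norm x)\<^sup>2))"
      using mult_left_mono[OF c(2)[of x], of "real t"] by (simp add: mult_ac)
    also have "\<dots> \<le> real t * M' * norm x ^ 4 * exp (- (c * real t * (norm x)\<^sup>2))"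
    proof -
      have "1 * 1 * 1 \<le> real t * M' * norm x ^ 4"
        using \<open>0 < t\<close> M' x1 by (intro mult_mono one_le_power) auto
      then show ?thesis using mult_right_mono[of 1 _ "exp (- (c * real t * (norm x)\<^sup>2))"] by simp
    qed
    finally show ?thesis using False by simp
  qed
  show thesis
  proof
    show "0 < c / 2" using c by simp
    show "0 < 8 * M' / c\<^sup>2" using c M' by simp
    show "\<bar>indicator K x * charfun q d x ^ t - exp (- real t * half_variance q d x)\<bar>
      \<le> 8 * M' / c\<^sup>2 / real t * exp (- (c / 2 * real t) * (norm x)\<^sup>2)" if "0 < t" for x t
    proof -
      \<comment> \<open>Half of the available exponent. The bound
        \<open>y\<^sup>2 \<le> 2 * exp y\<close> absorbs the fourth power, leaving
        \<open>exp (- y)\<close> and, from the square of \<open>c * t\<close> in the denominator,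
        the factor \<open>1 / t\<close>.\<close>
      define y where "y = c * real t * (norm x)\<^sup>2 / 2"
      have y: "0 \<le> y" using c by (simp add: y_def)
      have "norm x ^ 4 = 4 * y\<^sup>2 / (c * real t)\<^sup>2"
        using c \<open>0 < t\<close> by (simp add: y_def power_divide power_mult_distrib flip: power_mult)
      also have "\<dots> \<le> 4 * (2 * exp y) / (c * real t)\<^sup>2"
        using exp_lower_Taylor_quadratic[OF y] y by (intro divide_right_mono mult_left_mono) auto
      finally have "real t * M' * norm x ^ 4 * exp (- (2 * y)) \<le>
          real t * M' * (4 * (2 * exp y) / (c * real t)\<^sup>2) * exp (- (2 * y))"
        using M' by (intro mult_right_mono mult_left_mono) auto
      also have "\<dots> = 8 * M' / c\<^sup>2 / real t * exp (- y)"
        using \<open>0 < t\<close> c by (simp add: power2_eq_square field_simps flip: exp_add)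
      finally show ?thesis
        using main[OF \<open>0 < t\<close>, of x] by (simp add: y_def)
    qed
  qed
qed

end

text \<open>The matrix of the quadratic form \<open>half_variance\<close>. If \<open>d\<close> is
  the difference of two independent copies, the factor one half makes it the covariance of one
  copy.\<close>

definition half_covariance :: "('i::finite \<Rightarrow> real) \<Rightarrow> ('i \<Rightarrow> real^'n) \<Rightarrow> real^'n^'n" where
  "half_covariance q d = (\<chi> a b. (\<Sum>i\<in>UNIV. q i * (d i $ a * d i $ b)) / 2)"

text \<open>
  The quadratic form is the squared norm of a linear map into the space indexed by the
  steps; an isometry moves its range back into the original space.
\<close>

lemma half_variance_factorization:
  fixes q :: "'i::finite \<Rightarrow> real" and d :: "'i \<Rightarrow> real^'n"
  assumes "\<And>i. 0 \<le> q i"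
  obtains A :: "real^'n^'n" where "\<And>x. (norm (A *v x))\<^sup>2 = half_variance q d x"
    "det (half_covariance q d) = (det A)\<^sup>2"
proof -
  define U :: "real^'n \<Rightarrow> real^'i" where "U x = (\<chi> i. sqrt (q i / 2) * (d i \<bullet> x))" for x
  have U: "linear U"
    by (rule linearI) (simp_all add: U_def vec_eq_iff inner_add_right algebra_simps)
  have nU: "(norm (U x))\<^sup>2 = half_variance q d x" for x
    using assms by (simp add: U_def norm_vec_def L2_set_def half_variance_def sum_nonneg
        power_mult_distrib sum_divide_distrib)
  have "dim (range U) \<le> dim (UNIV :: (real^'n) set)"
    using dim_image_le[OF U, of UNIV] .
  then obtain f :: "real^'i \<Rightarrow> real^'n" where f: "linear f" "\<And>x. x \<in> range U \<Longrightarrow> norm (f x) = norm x"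
    using isometry_subset_subspace[of "range U" "UNIV :: (real^'n) set"] U
    by (metis linear_subspace_image subspace_UNIV)
  define A where "A = matrix (f \<circ> U)"
  have A: "A *v x = f (U x)" for x
    unfolding A_def by (simp add: matrix_works linear_matrix_vector_mul_eq linear_compose U f)
  have nA: "(norm (A *v x))\<^sup>2 = half_variance q d x" for x
    by (simp add: A f nU)
  \<comment> \<open>Polarization recovers the bilinear form; on basis vectors it gives the entries
    of \<open>transpose A ** A\<close>.\<close>
  have pol: "(A *v x) \<bullet> (A *v y) = (\<Sum>i\<in>UNIV. q i * ((d i \<bullet> x) * (d i \<bullet> y))) / 2" for x y
  proof -
    have "2 * ((A *v x) \<bullet> (A *v y)) = (norm (A *v (x + y)))\<^sup>2 - (norm (A *v x))\<^sup>2 - (norm (A *v y))\<^sup>2"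
      by (simp add: power2_norm_eq_inner matrix_vector_right_distrib inner_add_left inner_add_right inner_commute)
    also have "\<dots> = (\<Sum>i\<in>UNIV. q i * ((d i \<bullet> x) * (d i \<bullet> y)))"
      unfolding nA half_variance_def
      by (simp add: inner_add_right power2_sum algebra_simps sum.distrib
          add_divide_distrib sum_distrib_left[symmetric])
         (simp add: mult.left_commute[of _ 2] sum_distrib_left[symmetric])
    finally show ?thesis by simp
  qed
  have "transpose A ** A = half_covariance q d"
  proof (simp add: vec_eq_iff, intro allI)
    fix a b
    have "(transpose A ** A) $ a $ b = (A *v axis a 1) \<bullet> (A *v axis b 1)"
      by (simp add: matrix_matrix_mult_def transpose_def inner_vec_def matrix_vector_mult_basis column_def)
    also have "\<dots> = half_covariance q d $ a $ b"
      by (simp add: pol half_covariance_def inner_axis)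
    finally show "(transpose A ** A) $ a $ b = half_covariance q d $ a $ b" .
  qed
  then have "det (half_covariance q d) = (det A)\<^sup>2"
    by (metis det_mul det_transpose power2_eq_square)
  with nA show thesis by (rule that)
qed

text \<open>The pointwise estimate is integrated over the whole space. The indicator sits inside it,
  so the Gaussian mass outside the cube is already accounted for, and the bound contributes
  \<open>1 / t\<close> beside the usual Gaussian scaling.\<close>

lemma torus_integral_charfun_power:
  fixes q :: "'i::finite \<Rightarrow> real" and d :: "'i \<Rightarrow> real^'n"
  assumes q: "\<And>i. 0 \<le> q i" "(\<Sum>i\<in>UNIV. q i) = 1"
    and nonneg: "\<And>x. 0 \<le> charfun q d x"
    and aper: "\<And>x. x \<in> torus_cube \<Longrightarrow> (\<And>i. 0 < q i \<Longrightarrow> cos (d i \<bullet> x) = 1) \<Longrightarrow> x = 0"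
    and det: "det (half_covariance q d) \<noteq> 0"
  shows "\<exists>E. \<forall>t>0.
    \<bar>(LINT x : torus_cube | lborel. charfun q d x ^ t)
      - (pi / real t) powr (real CARD('n) / 2) / sqrt (det (half_covariance q d))\<bar>
    \<le> E * real t powr (- (real CARD('n) / 2 + 1))"
proof -
  obtain A :: "real^'n^'n" where A: "\<And>x. (norm (A *v x))\<^sup>2 = half_variance q d x"
    and dA: "det (half_covariance q d) = (det A)\<^sup>2"
    using half_variance_factorization[of q d, OF q(1)] by blast
  have dA0: "det A \<noteq> 0" using det dA by simp
  have pos: "0 < half_variance q d x" if "x \<noteq> 0" for x
  proof -
    have "A *v x \<noteq> 0"
      using dA0 that invertible_det_nz[of A] matrix_left_invertible_ker[of A]
      unfolding invertible_def by blast
    then show ?thesis by (simp add: A[symmetric])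
  qed
  have ball: "ball 0 1 \<subseteq> (torus_cube :: (real^'n) set)"
  proof
    fix x :: "real^'n" assume "x \<in> ball 0 1"
    then have "\<bar>x \<bullet> b\<bar> \<le> pi" if "b \<in> Basis" for b
      using Basis_le_norm[OF that, of x] pi_gt3 by simp
    then show "x \<in> torus_cube" by (simp add: mem_torus_cube)
  qed
  obtain c E where c: "0 < c" and E: "0 < E"
    and bd: "\<And>x t. 0 < t \<Longrightarrow>
      \<bar>indicator torus_cube x * charfun q d x ^ t - exp (- real t * half_variance q d x)\<bar>
      \<le> E / real t * exp (- (c * real t) * (norm x)\<^sup>2)"
    using charfun_power_approx[OF q nonneg pos aper compact_cbox ball] by metis
  define p where "p = real CARD('n) / 2"
  show ?thesis
  proof (intro exI allI impI)
    fix t :: nat assume t: "0 < t"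
    \<comment> \<open>As \<open>half_variance q d x\<close> is the squared norm of
      \<open>A *v x\<close>, substituting \<open>A\<close> reduces this to the rotation-invariant
      Gaussian.\<close>
    have G: "has_bochner_integral lborel (\<lambda>x. exp (- real t * half_variance q d x))
        ((pi / real t) powr p / \<bar>det A\<bar>)"
      using has_bochner_integral_linear[OF dA0 has_bochner_integral_gaussian[where 'a = "real^'n" and c = "real t"]] t
      by (simp add: A p_def)
    have H: "has_bochner_integral lborel (\<lambda>x::real^'n. E / real t * exp (- (c * real t) * (norm x)\<^sup>2))
        (E / real t * (pi / (c * real t)) powr p)"
      using has_bochner_integral_gaussian[where 'a = "real^'n" and c = "c * real t"] t c
      by (intro has_bochner_integral_mult_right) (simp add: p_def)
    have cont: "continuous_on UNIV (\<lambda>x. charfun q d x ^ t)"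
      unfolding charfun_def by (intro continuous_intros)
    have I: "integrable lborel (\<lambda>x. indicator torus_cube x * charfun q d x ^ t)"
      using borel_integrable_compact[OF compact_cbox continuous_on_subset[OF cont]]
      by (simp add: indicator_scaleR_eq_if[symmetric] cong: if_cong)
    have "\<bar>(LINT x : torus_cube | lborel. charfun q d x ^ t) - (pi / real t) powr p / \<bar>det A\<bar>\<bar> =
        \<bar>LINT x | lborel. indicator torus_cube x * charfun q d x ^ t - exp (- real t * half_variance q d x)\<bar>"
      using G I by (simp add: set_lebesgue_integral_def has_bochner_integral_iff)
    also have "\<dots> \<le> (LINT x | lborel. \<bar>indicator torus_cube x * charfun q d x ^ t - exp (- real t * half_variance q d x)\<bar>)"
      by (rule integral_abs_bound)
    also have "\<dots> \<le> (LINT x | lborel. E / real t * exp (- (c * real t) * (norm (x::real^'n))\<^sup>2))"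
      using G H I bd[OF t] by (intro integral_mono) (auto simp: has_bochner_integral_iff)
    also have "\<dots> = E / real t * (pi / (c * real t)) powr p"
      using H by (simp add: has_bochner_integral_iff)
    also have "\<dots> = E * (pi / c) powr p * real t powr (- (p + 1))"
    proof -
      have "real t powr (- (p + 1)) = 1 / (real t powr p * real t)"
        using t by (simp only: powr_minus_divide powr_add) simp
      then show ?thesis
        using t c by (simp add: powr_divide powr_mult)
    qed
    finally show "\<bar>(LINT x : torus_cube | lborel. charfun q d x ^ t)
      - (pi / real t) powr (real CARD('n) / 2) / sqrt (det (half_covariance q d))\<bar>
      \<le> E * (pi / c) powr p * real t powr (- (real CARD('n) / 2 + 1))"
      by (simp add: p_def dA)
  qed
qed

section \<open>Lattice coordinates of the frequencies\<close>

definition real_vec :: "int^'n \<Rightarrow> real^'n" where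
  "real_vec v = (\<chi> j. real_of_int (v $ j))"

lemma real_vec_nth [simp]: "real_vec v $ j = real_of_int (v $ j)"
  by (simp add: real_vec_def)

lemma real_vec_eq_0_iff [simp]: "real_vec v = 0 \<longleftrightarrow> v = 0"
  by (simp add: vec_eq_iff)

lemma real_vec_sum: "real_vec (\<Sum>i\<in>I. f i) = (\<Sum>i\<in>I. real_vec (f i))"
  by (simp add: vec_eq_iff sum_component)

lemma real_vec_diff: "real_vec (v - w) = real_vec v - real_vec w"
  by (simp add: vec_eq_iff)

lemma real_vec_add: "real_vec (v + w) = real_vec v + real_vec w"
  by (simp add: vec_eq_iff)

lemma real_vec_inner_Basis: "b \<in> Basis \<Longrightarrow> real_vec v \<bullet> b \<in> \<int>"
  by (auto simp: Basis_vec_def inner_axis)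

definition real_matrix :: "int^'n^'m \<Rightarrow> real^'n^'m" where
  "real_matrix B = (\<chi> i j. real_of_int (B $ i $ j))"

lemma real_vec_vector_matrix_mult: "real_vec (v v* B) = real_vec v v* real_matrix B"
  by (simp add: vec_eq_iff vector_matrix_mult_def real_matrix_def)

lemma det_real_matrix: "det (real_matrix B) = real_of_int (det B)"
  by (simp add: det_def real_matrix_def)

text \<open>An integer matrix with nonzero determinant may lack an integer inverse, so the kernel is
  computed over the reals.\<close>

lemma vector_matrix_mult_eq_0_iff:
  fixes B :: "int^'n^'n"
  assumes "det B \<noteq> 0"
  shows "v v* B = 0 \<longleftrightarrow> v = 0"
proof
  assume "v v* B = 0"
  then have "transpose (real_matrix B) *v real_vec v = 0"
    by (metis real_vec_eq_0_iff real_vec_vector_matrix_mult transpose_matrix_vector)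
  moreover have "invertible (transpose (real_matrix B))"
    using assms by (simp add: invertible_det_nz det_real_matrix)
  ultimately have "real_vec v = 0"
    using matrix_left_invertible_ker[of "transpose (real_matrix B)"] unfolding invertible_def by blast
  then show "v = 0" by simp
qed (simp add: vec_eq_iff vector_matrix_mult_def)

lemma vector_matrix_mult_diff_int:
  fixes B :: "int^'n^'m"
  shows "(v - w) v* B = v v* B - w v* B"
  by (simp add: vec_eq_iff vector_matrix_mult_def algebra_simps sum_subtractf)

text \<open>The matrix version is applied to the matrix all of whose rows are \<open>v\<close>; any
  row of the resulting \<open>P\<close> serves as \<open>c\<close>.\<close>

lemma span_rows_imp_vector_matrix_mult:
  fixes B :: "int^'n^'n"
  assumes "v \<in> int_vec.span (rows B)"
  shows "\<exists>c. v = c v* B"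
proof -
  have "rows ((\<chi> i. v) :: int^'n^'n) \<subseteq> int_vec.span (rows B)"
    using assms by (auto simp: rows_def row_def)
  then obtain P :: "int^'n^'n" where "(\<chi> i. v) = P ** B"
    using span_rows_imp_matrix_mult by blast
  then have "v = P $ i v* B" for i
    by (simp add: vec_eq_iff matrix_matrix_mult_def vector_matrix_mult_def mult.commute)
  then show ?thesis by blast
qed

lemma sum_vector_matrix_mult:
  fixes B :: "int^'n^'m"
  shows "(\<Sum>i\<in>I. f i) v* B = (\<Sum>i\<in>I. f i v* B)"
  by (simp add: vec_eq_iff vector_matrix_mult_def sum_distrib_right sum_component sum.swap[of _ I])

lemma det_half_covariance_vector_matrix_mult:
  fixes d :: "'i::finite \<Rightarrow> real^'n" and B :: "real^'n^'n"
  shows "det (half_covariance q (\<lambda>i. d i v* B)) = (det B)\<^sup>2 * det (half_covariance q d)"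
proof -
  have "half_covariance q (\<lambda>i. d i v* B) = transpose B ** (half_covariance q d ** B)"
  proof (simp add: vec_eq_iff, intro allI)
    fix a b
    have "(transpose B ** (half_covariance q d ** B)) $ a $ b =
        (\<Sum>k\<in>UNIV. \<Sum>l\<in>UNIV. \<Sum>i\<in>UNIV. B $ k $ a * (q i * (d i $ k * d i $ l) * B $ l $ b)) / 2"
      by (simp add: matrix_matrix_mult_def transpose_def half_covariance_def
          sum_distrib_left sum_distrib_right sum_divide_distrib)
    also have "\<dots> = (\<Sum>i\<in>UNIV. \<Sum>k\<in>UNIV. \<Sum>l\<in>UNIV. B $ k $ a * (q i * (d i $ k * d i $ l) * B $ l $ b)) / 2"
      by (simp add: sum.swap[of _ "UNIV :: 'n set" "UNIV :: 'i set"])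
    also have "\<dots> = half_covariance q (\<lambda>i. d i v* B) $ a $ b"
    proof -
      have "(d i v* B) $ a * (d i v* B) $ b =
          (\<Sum>k\<in>UNIV. \<Sum>l\<in>UNIV. d i $ k * d i $ l * (B $ k $ a * B $ l $ b))" for i
        unfolding vector_matrix_mult_def vec_lambda_beta sum_product
        by (intro sum.cong refl) (simp add: mult_ac)
      then show ?thesis
        by (simp add: half_covariance_def sum_distrib_left mult_ac)
    qed
    finally show "half_covariance q (\<lambda>i. d i v* B) $ a $ b = (transpose B ** (half_covariance q d ** B)) $ a $ b" ..
  qed
  then show ?thesis
    by (simp add: det_mul power2_eq_square)
qed

text \<open>Multiplying by the conjugate gives a sum over pairs, with the weights and values of a
  difference of two independent copies. Real parts yield the cosine form.\<close>

lemma cmod_exp_sum_squared: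
  fixes p a :: "'d::finite \<Rightarrow> real"
  shows "complex_of_real ((cmod (\<Sum>x\<in>UNIV. of_real (p x) * exp (\<i> * of_real (a x))))\<^sup>2) =
      (\<Sum>z\<in>UNIV. of_real (p (fst z) * p (snd z)) * exp (\<i> * of_real (a (fst z) - a (snd z))))"
    (is "?L = ?R")
    and "(cmod (\<Sum>x\<in>UNIV. of_real (p x) * exp (\<i> * of_real (a x))))\<^sup>2 =
      (\<Sum>z\<in>UNIV. p (fst z) * p (snd z) * cos (a (fst z) - a (snd z)))"
proof -
  have "?L = (\<Sum>x\<in>UNIV. \<Sum>y\<in>UNIV. of_real (p x * p y) * exp (\<i> * of_real (a x - a y)))"
    unfolding complex_norm_square cnj_sum sum_product
    by (intro sum.cong refl) (simp add: exp_cnj exp_diff exp_minus right_diff_distrib divide_inverse)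
  also have "\<dots> = ?R"
    by (simp add: sum.cartesian_product case_prod_unfold del: of_real_diff of_real_mult)
  finally show eq: "?L = ?R" .
  have "Re ?L = Re ?R" using eq by (rule arg_cong)
  then show "(cmod (\<Sum>x\<in>UNIV. of_real (p x) * exp (\<i> * of_real (a x))))\<^sup>2 =
      (\<Sum>z\<in>UNIV. p (fst z) * p (snd z) * cos (a (fst z) - a (snd z)))"
    by (simp add: Re_exp del: of_real_diff of_real_mult)
qed

text \<open>The product of the adjoint evolution and the evolution is diagonal with the relative
  phases as entries, so the fidelity is the squared modulus of the characteristic function of
  \<open>K\<close> at \<open>\<theta>' - \<theta>\<close>.\<close>

lemma fidelity_eq:
  "fidelity \<psi> k \<theta> \<theta>' =
    (cmod (\<Sum>x\<in>UNIV. of_real ((cmod (\<psi> $ x))\<^sup>2) * exp (\<i> * of_real (real_vec (k x) \<bullet> (\<theta>' - \<theta>)))))\<^sup>2"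
proof -
  define e where "e \<theta> x = \<i> * of_real (\<Sum>j\<in>UNIV. \<theta> $ j * real_of_int (k x $ j))" for \<theta> x
  define w where "w x = exp (\<i> * of_real (real_vec (k x) \<bullet> (\<theta>' - \<theta>)))" for x
  have ev: "evolution k \<theta> = (\<chi> x y. if x = y then exp (e \<theta> x) else 0)" for \<theta>
    by (simp only: evolution_eq e_def)
  have w: "cnj (exp (e \<theta> x)) * exp (e \<theta>' x) = w x" for x
  proof -
    have "cnj (e \<theta> x) + e \<theta>' x =
        \<i> * of_real ((\<Sum>j\<in>UNIV. \<theta>' $ j * real_of_int (k x $ j)) - (\<Sum>j\<in>UNIV. \<theta> $ j * real_of_int (k x $ j)))"
      by (simp add: e_def right_diff_distrib del: of_real_sum)
    also have "(\<Sum>j\<in>UNIV. \<theta>' $ j * real_of_int (k x $ j)) - (\<Sum>j\<in>UNIV. \<theta> $ j * real_of_int (k x $ j)) =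
        real_vec (k x) \<bullet> (\<theta>' - \<theta>)"
      by (simp add: inner_vec_def right_diff_distrib sum_subtractf mult.commute)
    finally show ?thesis by (simp add: w_def exp_cnj flip: exp_add)
  qed
  have "adjoint_matrix (evolution k \<theta>) ** evolution k \<theta>' = (\<chi> x y. if x = y then w x else 0)"
  proof -
    have "(\<Sum>z\<in>UNIV. cnj (if z = x then exp (e \<theta> z) else 0) * (if z = y then exp (e \<theta>' z) else 0)) =
        (if x = y then w x else 0)" for x y
    proof -
      have "(\<Sum>z\<in>UNIV. cnj (if z = x then exp (e \<theta> z) else 0) * (if z = y then exp (e \<theta>' z) else 0)) =
          (\<Sum>z\<in>UNIV. if z = x then (if x = y then cnj (exp (e \<theta> x)) * exp (e \<theta>' x) else 0) else 0)"
        by (intro sum.cong refl) simp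
      then show ?thesis by (simp only: w) simp
    qed
    then show ?thesis
      by (simp only: vec_eq_iff adjoint_matrix_def ev matrix_matrix_mult_def vec_lambda_beta) simp
  qed
  then have "cinner \<psi> ((adjoint_matrix (evolution k \<theta>) ** evolution k \<theta>') *v \<psi>) =
      (\<Sum>x\<in>UNIV. of_real ((cmod (\<psi> $ x))\<^sup>2) * w x)"
    by (simp add: cinner_def matrix_vector_mult_def if_distrib if_distribR
        complex_norm_square mult_ac cong: if_cong del: of_real_power)
  then show ?thesis by (simp only: fidelity_def w_def)
qed

text \<open>The covariance of a random vector is half the second moment of the difference of two
  independent copies.\<close>

lemma covariance_matrix_freq_pmf:
  assumes "norm \<psi> = 1"
  shows "covariance_matrix (freq_pmf \<psi> k) =
    half_covariance (\<lambda>z. (cmod (\<psi> $ fst z))\<^sup>2 * (cmod (\<psi> $ snd z))\<^sup>2)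
      (\<lambda>z. real_vec (k (fst z) - k (snd z)))"
proof -
  define p where "p x = (cmod (\<psi> $ x))\<^sup>2" for x
  have p1: "(\<Sum>x\<in>UNIV. p x) = 1"
    using assms by (simp add: p_def norm_vec_def L2_set_def)
  have E: "measure_pmf.expectation (freq_pmf \<psi> k) f = (\<Sum>x\<in>UNIV. p x * f (k x))" for f :: "_ \<Rightarrow> real"
    unfolding freq_pmf_def integral_map_pmf
    by (subst integral_measure_pmf[of UNIV]) (simp_all add: pmf_index_pmf[OF assms] p_def)
  have "(\<Sum>x\<in>UNIV. p x * ((f x - (\<Sum>y\<in>UNIV. p y * f y)) * (g x - (\<Sum>y\<in>UNIV. p y * g y)))) =
      (\<Sum>z\<in>UNIV. p (fst z) * p (snd z) * ((f (fst z) - f (snd z)) * (g (fst z) - g (snd z)))) / 2"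
    (is "?L = ?R") for f g
  proof -
    \<comment> \<open>The two means and the mixed moment; both sides equal
      \<open>H - F * G\<close>.\<close>
    define F G H where "F = (\<Sum>x\<in>UNIV. p x * f x)" and "G = (\<Sum>x\<in>UNIV. p x * g x)"
      and "H = (\<Sum>x\<in>UNIV. p x * (f x * g x))"
    have "?L = (\<Sum>x\<in>UNIV. p x * (f x * g x) - G * (p x * f x) - F * (p x * g x) + F * G * p x)"
      unfolding F_def[symmetric] G_def[symmetric] by (intro sum.cong refl) (simp add: algebra_simps)
    also have "\<dots> = H - G * F - F * G + F * G * 1"
      unfolding sum.distrib sum_subtractf sum_distrib_left[symmetric] p1 F_def G_def H_def ..
    finally have L: "?L = H - F * G" by simp
    have "(\<Sum>z\<in>UNIV. p (fst z) * p (snd z) * ((f (fst z) - f (snd z)) * (g (fst z) - g (snd z)))) =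
        (\<Sum>x\<in>UNIV. \<Sum>y\<in>UNIV. p x * p y * ((f x - f y) * (g x - g y)))"
      by (simp add: sum.cartesian_product case_prod_unfold)
    also have "\<dots> = (\<Sum>x\<in>UNIV. \<Sum>y\<in>UNIV. p x * (f x * g x) * p y - p x * f x * (p y * g y)
        - p x * g x * (p y * f y) + p x * (p y * (f y * g y)))"
      by (intro sum.cong refl) (simp add: algebra_simps)
    also have "\<dots> = H * 1 - F * G - G * F + 1 * H"
      unfolding sum.distrib sum_subtractf sum_product[symmetric] p1 F_def G_def H_def ..
    finally show ?thesis unfolding L by simp
  qed
  then show ?thesis
    by (simp add: covariance_matrix_def half_covariance_def E vec_eq_iff flip: p_def)
qed

lemma mem_param_cube: "x \<in> param_cube \<longleftrightarrow> (\<forall>j. \<bar>x $ j\<bar> \<le> pi)"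
  by (simp add: param_cube_def mem_box_cart abs_le_iff minus_le_iff conj_commute)

lemma param_cube_eq: "(param_cube :: (real^'n) set) = torus_cube"
proof (rule set_eqI)
  fix x :: "real^'n"
  have "x \<in> torus_cube \<longleftrightarrow> (\<forall>j. \<bar>x $ j\<bar> \<le> pi)"
    unfolding mem_torus_cube by (auto simp: Basis_vec_def inner_axis)
  then show "x \<in> param_cube \<longleftrightarrow> x \<in> torus_cube" by (simp only: mem_param_cube)
qed

lemma param_cube_Times_param_cube:
  "(param_cube :: (real^'n) set) \<times> (param_cube :: (real^'n) set) = torus_cube"
proof (rule set_eqI)
  fix z :: "(real^'n) \<times> (real^'n)"
  show "z \<in> param_cube \<times> param_cube \<longleftrightarrow> z \<in> torus_cube"
    unfolding param_cube_eq mem_Times_iff mem_torus_cube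
    by (cases z) (simp add: Basis_prod_def ball_Un)
qed

text \<open>Injectivity is stated because independence of the range, as a set, would not notice a
  repeated Hamiltonian. A combination of the Hamiltonians can still be constant on the support of
  the state, giving a zero denominator; the determinant hypothesis excludes this. Amplitudes may
  vanish, and the last hypothesis says that the differences of positive probability still generate
  the walk lattice.\<close>

theorem theorem2:
  fixes n :: nat
    and \<psi> :: "complex^'d"
    and k :: "'d \<Rightarrow> int^'N"
  assumes "1 \<le> n" and "n \<le> CARD('N)"
    and "CARD('d) = 2 ^ n"
    and "norm \<psi> = 1"
    and "inj (hamiltonian k)" and "independent (range (hamiltonian k))"
    and "det (covariance_matrix (freq_pmf \<psi> k)) \<noteq> 0"
    and "int_vec.span (set_pmf (step_pmf \<psi> k)) = walk_lattice k"
  shows "\<exists>c>0. \<forall>t::nat. t > 0 \<longrightarrow>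
    \<bar>frame_potential \<psi> k t - approx_frame_potential \<psi> k t\<bar>
      < c * real t powr (- (real CARD('N) / 2 + 1))"
proof -
  note norm_psi = assms(4) and det_cov = assms(7) and span_step = assms(8)

  \<comment> \<open>Frequencies in a basis of the walk lattice\<close>
  obtain B :: "int^'N^'N" where B: "int_vec.span (rows B) = walk_lattice k"
    using lattice_basis_matrix_exists[of "walk_lattice k"]
    by (auto simp: walk_lattice_def)
  have "k x - k y \<in> int_vec.span (rows B)" for x y
    unfolding B walk_lattice_def
    by (rule int_vec.span_base) (auto simp: freq_differences_def frequencies_def)
  \<comment> \<open>Only differences of frequencies need lie in the lattice, so an arbitrary basis
    state \<open>undefined\<close> serves as origin.\<close>
  then have "\<exists>v. k x - k undefined = v v* B" for x
    by (intro span_rows_imp_vector_matrix_mult)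
  then obtain l where l: "\<And>x. k x - k undefined = l x v* B"
    by metis
  have kl: "k x - k y = (l x - l y) v* B" for x y
    using l[of x] l[of y] by (simp add: vector_matrix_mult_diff_int algebra_simps)

  \<comment> \<open>The step distribution in lattice coordinates\<close>
  define p where "p x = (cmod (\<psi> $ x))\<^sup>2" for x
  define q where "q z = p (fst z) * p (snd z)" for z
  define d where "d z = real_vec (l (fst z) - l (snd z))" for z
  have p: "0 \<le> p x" "(\<Sum>x\<in>UNIV. p x) = 1" for x
    using norm_psi by (simp_all add: p_def norm_vec_def L2_set_def)
  have q: "0 \<le> q z" "(\<Sum>z\<in>UNIV. q z) = 1" for z
  proof -
    show "0 \<le> q z" by (simp add: q_def p)
    have "(\<Sum>z\<in>UNIV. q z) = (\<Sum>x\<in>UNIV. p x) * (\<Sum>x\<in>UNIV. p x)"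
      by (simp add: q_def sum_product sum.cartesian_product case_prod_unfold)
    then show "(\<Sum>z\<in>UNIV. q z) = 1" by (simp add: p)
  qed

  have "covariance_matrix (freq_pmf \<psi> k) = half_covariance q (\<lambda>z. d z v* real_matrix B)"
    unfolding covariance_matrix_freq_pmf[OF norm_psi] kl
    by (simp add: q_def[abs_def] p_def d_def[abs_def] real_vec_vector_matrix_mult)
  then have cov: "det (covariance_matrix (freq_pmf \<psi> k)) = (real_of_int (det B))\<^sup>2 * det (half_covariance q d)"
    by (simp add: det_half_covariance_vector_matrix_mult det_real_matrix)
  \<comment> \<open>A nonsingular covariance thus forces the lattice to have full rank as well as
    the form in lattice coordinates to be nondegenerate.\<close>
  with det_cov have dB: "det B \<noteq> 0" and dC: "det (half_covariance q d) \<noteq> 0"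
    by auto

  have chf: "charfun q d x = (cmod (\<Sum>y\<in>UNIV. of_real (p y) * exp (\<i> * of_real (real_vec (l y) \<bullet> x))))\<^sup>2" for x
    unfolding cmod_exp_sum_squared(2) charfun_def
    by (simp add: q_def d_def real_vec_diff inner_diff_left)

  have charfun_nonneg: "0 \<le> charfun q d x" for x
    unfolding chf by (rule zero_le_power2)

  \<comment> \<open>Aperiodicity on the cube\<close>
  have aper: "x = 0" if x: "x \<in> torus_cube" and cos1: "\<And>z. 0 < q z \<Longrightarrow> cos (d z \<bullet> x) = 1" for x
  proof -
    \<comment> \<open>The lattice vectors whose coordinates pair with \<open>x\<close> to a multiple
      of \<open>2 * pi\<close>. They form a subgroup containing all steps of positive probability,
      hence the whole lattice.\<close>
    define T where "T = {w. \<exists>v. w = v v* B \<and> (\<exists>m::int. real_vec v \<bullet> x = of_int m * (2 * pi))}"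
    have "int_vec.subspace T"
    proof (rule int_vec.subspaceI)
      show "0 \<in> T"
        unfolding T_def by (intro CollectI exI[of _ 0] conjI) (simp_all add: vec_eq_iff vector_matrix_mult_def inner_vec_def)
    next
      fix u w assume "u \<in> T" "w \<in> T"
      then obtain v v' m m' where "u = v v* B" "w = v' v* B"
        "real_vec v \<bullet> x = of_int m * (2 * pi)" "real_vec v' \<bullet> x = of_int m' * (2 * pi)"
        unfolding T_def by blast
      then have "u + w = (v + v') v* B" "real_vec (v + v') \<bullet> x = of_int (m + m') * (2 * pi)"
        by (simp_all add: vec_eq_iff vector_matrix_mult_def algebra_simps sum.distrib real_vec_add inner_add_left)
      then show "u + w \<in> T" unfolding T_def by blast
    next
      fix a u assume "u \<in> T"
      then obtain v m where "u = v v* B" "real_vec v \<bullet> x = of_int m * (2 * pi)"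
        unfolding T_def by blast
      moreover have "real_vec (a *s v) = of_int a *\<^sub>R real_vec v"
        by (simp add: vec_eq_iff)
      moreover have "a *s (v v* B) = (a *s v) v* B"
        by (simp add: vec_eq_iff vector_matrix_mult_def sum_distrib_left mult_ac)
      ultimately have "a *s u = (a *s v) v* B" "real_vec (a *s v) \<bullet> x = of_int (a * m) * (2 * pi)"
        by simp_all
      then show "a *s u \<in> T" unfolding T_def by blast
    qed
    moreover have "set_pmf (step_pmf \<psi> k) \<subseteq> T"
    proof
      fix w assume "w \<in> set_pmf (step_pmf \<psi> k)"
      then obtain y z where yz: "w = k y - k z" "y \<in> set_pmf (index_pmf \<psi>)" "z \<in> set_pmf (index_pmf \<psi>)"
        by (auto simp: step_pmf_def freq_pmf_def)
      have "0 < q (y, z)"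
        using yz(2,3) by (auto simp: q_def p_def set_pmf_iff pmf_index_pmf[OF norm_psi])
      then have "cos (d (y, z) \<bullet> x) = 1" by (rule cos1)
      then obtain m :: int where "d (y, z) \<bullet> x = of_int m * (2 * pi)"
        by (auto simp: cos_one_2pi_int mult.assoc)
      then show "w \<in> T"
        unfolding T_def yz(1) kl by (intro CollectI exI[of _ "l y - l z"]) (auto simp: d_def)
    qed
    ultimately have sub: "int_vec.span (rows B) \<subseteq> T"
      unfolding B span_step[symmetric] by (intro int_vec.span_minimal)
    have "x $ i = 0" for i
    proof -
      have "axis i 1 v* B = row i B"
        by (simp add: vec_eq_iff row_def vector_matrix_mult_def axis_def if_distrib
              if_distribR cong: if_cong)
      moreover have "row i B \<in> int_vec.span (rows B)"
        by (intro int_vec.span_base) (auto simp: rows_def)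
      ultimately obtain v m where v: "axis i 1 v* B = v v* B" and m: "real_vec v \<bullet> x = of_int m * (2 * pi)"
        using sub unfolding T_def by auto
      \<comment> \<open>Coordinates are unique, so the witness for the \<open>i\<close>-th basis row
        is the unit vector. Hence \<open>x $ i\<close> is a multiple of \<open>2 * pi\<close>, and
        of these the cube contains only 0.\<close>
      have "(axis i 1 - v) v* B = 0"
        using v by (simp add: vector_matrix_mult_diff_int)
      then have "v = axis i 1"
        using vector_matrix_mult_eq_0_iff[OF dB, of "axis i 1 - v"] by simp
      moreover have "real_vec (axis i 1) = axis i (1::real)"
        by (simp add: vec_eq_iff axis_def)
      ultimately have xi: "x $ i = of_int m * (2 * pi)"
        using m by (simp add: inner_axis')
      moreover have "\<bar>x $ i\<bar> \<le> pi"
        using x by (simp add: mem_param_cube flip: param_cube_eq)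
      ultimately have "\<bar>of_int m\<bar> * (2 * pi) \<le> 1 * pi" by (simp add: abs_mult)
      then have "\<bar>real_of_int m\<bar> * 2 \<le> 1" by simp
      then have "m = 0" by linarith
      then show ?thesis using xi by simp
    qed
    then show ?thesis by (simp add: vec_eq_iff)
  qed

  obtain E where E: "\<And>t. 0 < t \<Longrightarrow>
    \<bar>(LINT x : torus_cube | lborel. charfun q d x ^ t)
      - (pi / real t) powr (real CARD('N) / 2) / sqrt (det (half_covariance q d))\<bar>
    \<le> E * real t powr (- (real CARD('N) / 2 + 1))"
    using torus_integral_charfun_power[OF q charfun_nonneg aper dC] by blast

  \<comment> \<open>The frame potential as a torus average\<close>
  have frame: "frame_potential \<psi> k t = (LINT x : torus_cube | lborel. charfun q d x ^ t) / (2 * pi) ^ CARD('N)" for t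
  proof -
    \<comment> \<open>The fidelity depends on the parameters only through their difference; on pairs
      of parameters a frequency \<open>v\<close> becomes \<open>(- v, v)\<close>.\<close>
    define m :: "'d \<times> 'd \<Rightarrow> (real^'N) \<times> (real^'N)"
      where "m z = (- real_vec (k (fst z) - k (snd z)), real_vec (k (fst z) - k (snd z)))" for z
    have m_sum: "(\<Sum>s\<in>S. m (g s)) =
        (- real_vec (\<Sum>s\<in>S. k (fst (g s)) - k (snd (g s))), real_vec (\<Sum>s\<in>S. k (fst (g s)) - k (snd (g s))))"
      for g :: "nat \<Rightarrow> 'd \<times> 'd" and S
      by (simp add: m_def prod_eq_iff fst_sum snd_sum real_vec_sum sum_negf)
    have "(LINT z : torus_cube | lborel. fidelity \<psi> k (fst z) (snd z) ^ t) / (2 * pi) ^ DIM((real^'N) \<times> (real^'N)) =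
        (LINT x : torus_cube | lborel. charfun q d x ^ t) / (2 * pi) ^ DIM(real^'N)"
    proof (rule torus_average_cong[where m = m and m' = d and c = "\<lambda>z. of_real (q z)"])
      show "m z \<bullet> b \<in> \<int>" if "b \<in> Basis" for z b
        using that by (auto simp: m_def Basis_prod_def real_vec_inner_Basis)
      show "d z \<bullet> b \<in> \<int>" if "b \<in> Basis" for z b
        using that by (simp add: d_def real_vec_inner_Basis)
      show "of_real (fidelity \<psi> k (fst u) (snd u)) = (\<Sum>z\<in>UNIV. of_real (q z) * exp (\<i> * of_real (m z \<bullet> u)))" for u
      proof -
        have "m z \<bullet> u = real_vec (k (fst z)) \<bullet> (snd u - fst u) - real_vec (k (snd z)) \<bullet> (snd u - fst u)" for z
          by (cases u) (simp add: m_def real_vec_diff inner_diff_left inner_diff_right)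
        then show ?thesis
          unfolding fidelity_eq cmod_exp_sum_squared(1) by (simp only: q_def p_def)
      qed
      show "of_real (charfun q d x) = (\<Sum>z\<in>UNIV. of_real (q z) * exp (\<i> * of_real (d z \<bullet> x)))" for x
      proof -
        have "d z \<bullet> x = real_vec (l (fst z)) \<bullet> x - real_vec (l (snd z)) \<bullet> x" for z
          by (simp add: d_def real_vec_diff inner_diff_left)
        then show ?thesis
          unfolding chf cmod_exp_sum_squared(1) by (simp only: q_def)
      qed
      fix g :: "nat \<Rightarrow> 'd \<times> 'd"
      have "(\<Sum>s<t. m (g s)) = 0 \<longleftrightarrow> (\<Sum>s<t. k (fst (g s)) - k (snd (g s))) = 0"
        by (simp add: m_sum zero_prod_def)
      \<comment> \<open>Multiplication by \<open>B\<close> is injective, so the same words are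
        closed in both coordinate systems.\<close>
      also have "\<dots> \<longleftrightarrow> (\<Sum>s<t. l (fst (g s)) - l (snd (g s))) v* B = 0"
        by (simp add: kl sum_vector_matrix_mult)
      also have "\<dots> \<longleftrightarrow> (\<Sum>s<t. d (g s)) = 0"
        unfolding vector_matrix_mult_eq_0_iff[OF dB] d_def real_vec_sum[symmetric] real_vec_eq_0_iff ..
      finally show "(\<Sum>s<t. m (g s)) = 0 \<longleftrightarrow> (\<Sum>s<t. d (g s)) = 0" .
    qed
    moreover have "DIM((real^'N) \<times> (real^'N)) = 2 * CARD('N)" "DIM(real^'N) = CARD('N)"
      by simp_all
    ultimately show ?thesis
      unfolding frame_potential_def param_cube_Times_param_cube by (simp only:) simp
  qed

  \<comment> \<open>The main term in lattice coordinates\<close>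
  have approx: "approx_frame_potential \<psi> k t =
      (pi / real t) powr (real CARD('N) / 2) / sqrt (det (half_covariance q d)) / (2 * pi) ^ CARD('N)"
    if "0 < t" for t
  proof -
    \<comment> \<open>The lattice volume is \<open>\<bar>det B\<bar>\<close>, which cancels against
      the same factor in the root of the covariance determinant.\<close>
    have "approx_frame_potential \<psi> k t = 1 / ((4 * pi * real t) powr (real CARD('N) / 2) * sqrt (det (half_covariance q d)))"
      using dB by (simp add: approx_frame_potential_def lattice_volume_eq[OF B] cov real_sqrt_mult)
    also have "(4 * pi * real t) powr (real CARD('N) / 2) = (2 * pi) ^ CARD('N) / (pi / real t) powr (real CARD('N) / 2)"
    proof -
      have "(4 * pi * real t) * (pi / real t) = (2 * pi)\<^sup>2"
        using that by (simp add: power2_eq_square)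
      then have "(4 * pi * real t) powr (real CARD('N) / 2) * (pi / real t) powr (real CARD('N) / 2) =
          ((2 * pi)\<^sup>2) powr (real CARD('N) / 2)"
        by (metis powr_mult)
      also have "\<dots> = (2 * pi) powr (2 * (real CARD('N) / 2))"
        by (subst powr_numeral[symmetric]) (simp_all only: powr_powr, simp)
      also have "\<dots> = (2 * pi) ^ CARD('N)"
        by (simp add: powr_realpow)
      finally show ?thesis using that by (simp add: field_simps)
    qed
    finally show ?thesis by simp
  qed

  \<comment> \<open>The sign of \<open>E\<close> is unknown, and the claim is strict:
    \<open>\<bar>E\<bar> + 1\<close> is positive and strictly larger than \<open>E\<close>.\<close>
  define c where "c = (\<bar>E\<bar> + 1) / (2 * pi) ^ CARD('N)"
  have "\<bar>frame_potential \<psi> k t - approx_frame_potential \<psi> k t\<bar>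
      < c * real t powr (- (real CARD('N) / 2 + 1))" if t: "0 < t" for t
  proof -
    have "\<bar>frame_potential \<psi> k t - approx_frame_potential \<psi> k t\<bar> =
        \<bar>(LINT x : torus_cube | lborel. charfun q d x ^ t)
          - (pi / real t) powr (real CARD('N) / 2) / sqrt (det (half_covariance q d))\<bar> / (2 * pi) ^ CARD('N)"
      unfolding frame approx[OF t] diff_divide_distrib[symmetric] abs_divide by simp
    also have "\<dots> \<le> E * real t powr (- (real CARD('N) / 2 + 1)) / (2 * pi) ^ CARD('N)"
      using E[OF t] by (rule divide_right_mono) simp
    also have "\<dots> < (\<bar>E\<bar> + 1) * real t powr (- (real CARD('N) / 2 + 1)) / (2 * pi) ^ CARD('N)"
      using t by (intro divide_strict_right_mono mult_strict_right_mono) auto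
    finally show ?thesis by (simp add: c_def)
  qed
  moreover have "0 < c" by (simp add: c_def add_nonneg_pos)
  ultimately show ?thesis by blast
qed

end
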